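(* Let $(M,g)$ be a Riemannian manifold, endowed with its Riemannian distance $d$. Let $k\ge1$ be a real number and let $\gamma:[a,b]\to M$ be a curve of class m-$\mathcal{C}^1_k$ such that $t\mapsto\mathrm{meas}^k_t(\gamma)$ does not vanish identically on $[a,b]$. Then $k=1$.
   Context: A continuous curve $\gamma:[a,b]\to M$ in a metric space $(M,d)$ is m-differentiable of degree $k$ at $t\in[a,b]$ if $\lim_{s\to0,\ t+s\in[a,b]} d(\gamma(t+s),\gamma(t))/|s|^{1/k}$ exists and is finite; then $\mathrm{meas}^k_t(\gamma)$ denotes the $k$-th power of this limit. The curve is of class m-$\mathcal{C}^1_k$ if it is m-differentiable of degree $k$ at every $t\in[a,b]$ and $t\mapsto\mathrm{meas}^k_t(\gamma)$ is continuous on $[a,b]$. *)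

theory Defs
  imports "HOL-Analysis.Analysis"
begin

section \<open>Curves of class m-C1 in a metric space\<close>

definition m_quotient ::
  "('a \<Rightarrow> 'a \<Rightarrow> real) \<Rightarrow> real \<Rightarrow> (real \<Rightarrow> 'a) \<Rightarrow> real \<Rightarrow> real \<Rightarrow> real" where
  "m_quotient d k \<gamma> t s = d (\<gamma> (t + s)) (\<gamma> t) / \<bar>s\<bar> powr (1 / k)"

definition m_differentiable ::
  "('a \<Rightarrow> 'a \<Rightarrow> real) \<Rightarrow> real \<Rightarrow> real \<Rightarrow> real \<Rightarrow> (real \<Rightarrow> 'a) \<Rightarrow> real \<Rightarrow> bool" where
  "m_differentiable d k a b \<gamma> t \<longleftrightarrow>
     (\<exists>l. (m_quotient d k \<gamma> t \<longlongrightarrow> l) (at 0 within {s. t + s \<in> {a..b}}))"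

definition meas ::
  "('a \<Rightarrow> 'a \<Rightarrow> real) \<Rightarrow> real \<Rightarrow> real \<Rightarrow> real \<Rightarrow> (real \<Rightarrow> 'a) \<Rightarrow> real \<Rightarrow> real" where
  "meas d k a b \<gamma> t =
     (Lim (at 0 within {s. t + s \<in> {a..b}}) (m_quotient d k \<gamma> t)) powr k"

definition m_C1 ::
  "'a set \<Rightarrow> ('a \<Rightarrow> 'a \<Rightarrow> real) \<Rightarrow> real \<Rightarrow> real \<Rightarrow> real \<Rightarrow> (real \<Rightarrow> 'a) \<Rightarrow> bool" where
  "m_C1 M d k a b \<gamma> \<longleftrightarrow>
     continuous_map (top_of_set {a..b}) (Metric_space.mtopology M d) \<gamma> \<and>
     (\<forall>t\<in>{a..b}. m_differentiable d k a b \<gamma> t) \<and>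
     continuous_on {a..b} (meas d k a b \<gamma>)"


section \<open>Smooth maps between Euclidean spaces\<close>

text \<open>Only meant for open \<open>S\<close>. Since the domain is finite-dimensional, continuity of all
  iterated directional derivatives is the same as continuity of the iterated Frechet derivatives.\<close>

primrec Ck_on ::
  "nat \<Rightarrow> 'e::euclidean_space set \<Rightarrow> ('e \<Rightarrow> 'f::real_normed_vector) \<Rightarrow> bool" where
  "Ck_on 0 S f \<longleftrightarrow> continuous_on S f"
| "Ck_on (Suc n) S f \<longleftrightarrow>
     (\<forall>x\<in>S. f differentiable (at x)) \<and>
     (\<forall>v. Ck_on n S (\<lambda>x. frechet_derivative f (at x) v))"

definition smooth_on ::
  "'e::euclidean_space set \<Rightarrow> ('e \<Rightarrow> 'f::real_normed_vector) \<Rightarrow> bool" where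
  "smooth_on S f \<longleftrightarrow> (\<forall>n. Ck_on n S f)"


section \<open>Riemannian manifolds\<close>

type_synonym ('a, 'e) chart = "'a set \<times> ('a \<Rightarrow> 'e)"

definition transition ::
  "('a, 'e::euclidean_space) chart \<Rightarrow> ('a, 'e) chart \<Rightarrow> 'e \<Rightarrow> 'e" where
  "transition c c' = snd c' \<circ> inv_into (fst c) (snd c)"

locale smooth_manifold =
  fixes X :: "'a topology"
    and \<A> :: "('a, 'e::euclidean_space) chart set"
  assumes Hausdorff: "Hausdorff_space X"
    and second_countable: "second_countable X"
    and chart_domain: "(U, \<phi>) \<in> \<A> \<Longrightarrow> openin X U"
    and chart_image: "(U, \<phi>) \<in> \<A> \<Longrightarrow> open (\<phi> ` U)"
    and chart_homeo:
      "(U, \<phi>) \<in> \<A> \<Longrightarrow> homeomorphic_map (subtopology X U) (top_of_set (\<phi> ` U)) \<phi>"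
    and charts_cover: "(\<Union>(U, \<phi>)\<in>\<A>. U) = topspace X"
    and smooth_transition:
      "\<lbrakk>(U, \<phi>) \<in> \<A>; (V, \<psi>) \<in> \<A>\<rbrakk> \<Longrightarrow> smooth_on (\<phi> ` (U \<inter> V)) (transition (U, \<phi>) (V, \<psi>))"

text \<open>The metric is a smooth positive definite symmetric covariant 2-tensor field, given by its
  coordinate expressions: \<open>g (U, \<phi>) p v w\<close> is the inner product at \<open>p\<close> of the tangent vectors
  whose coordinates in the chart \<open>(U, \<phi>)\<close> are \<open>v\<close> and \<open>w\<close>. The last assumption is the tensor
  transformation law, that is, independence of the chart.\<close>

locale riemannian_manifold = smooth_manifold X \<A>
  for X :: "'a topology" and \<A> :: "('a, 'e::euclidean_space) chart set" +
  fixes g :: "('a, 'e) chart \<Rightarrow> 'a \<Rightarrow> 'e \<Rightarrow> 'e \<Rightarrow> real"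
  assumes metric_bilinear: "\<lbrakk>(U, \<phi>) \<in> \<A>; p \<in> U\<rbrakk> \<Longrightarrow> bilinear (g (U, \<phi>) p)"
    and metric_sym: "\<lbrakk>(U, \<phi>) \<in> \<A>; p \<in> U\<rbrakk> \<Longrightarrow> g (U, \<phi>) p v w = g (U, \<phi>) p w v"
    and metric_pos: "\<lbrakk>(U, \<phi>) \<in> \<A>; p \<in> U; v \<noteq> 0\<rbrakk> \<Longrightarrow> g (U, \<phi>) p v v > 0"
    and metric_smooth:
      "(U, \<phi>) \<in> \<A> \<Longrightarrow> smooth_on (\<phi> ` U) (\<lambda>x. g (U, \<phi>) (inv_into U \<phi> x) v w)"
    and metric_transform:
      "\<lbrakk>(U, \<phi>) \<in> \<A>; (V, \<psi>) \<in> \<A>; p \<in> U \<inter> V\<rbrakk> \<Longrightarrow>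
        g (U, \<phi>) p v w =
        g (V, \<psi>) p (frechet_derivative (transition (U, \<phi>) (V, \<psi>)) (at (\<phi> p)) v)
                   (frechet_derivative (transition (U, \<phi>) (V, \<psi>)) (at (\<phi> p)) w)"

definition C1_curve ::
  "'a topology \<Rightarrow> ('a, 'e::euclidean_space) chart set \<Rightarrow> (real \<Rightarrow> 'a) \<Rightarrow> real \<Rightarrow> real \<Rightarrow> bool" where
  "C1_curve X \<A> c \<alpha> \<beta> \<longleftrightarrow>
     continuous_map (top_of_set {\<alpha>..\<beta>}) X c \<and>
     (\<forall>(U, \<phi>)\<in>\<A>. \<exists>D. continuous_on ({\<alpha>..\<beta>} \<inter> c -` U) D \<and>
        (\<forall>t\<in>{\<alpha>..\<beta>} \<inter> c -` U. ((\<phi> \<circ> c) has_vector_derivative D t) (at t within {\<alpha>..\<beta>})))"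

text \<open>Unlike in the library's \<open>piecewise_C1_differentiable_on\<close>, the derivative has to extend
  continuously to the closed pieces, so that every curve has a finite length.\<close>

definition piecewise_C1_curve ::
  "'a topology \<Rightarrow> ('a, 'e::euclidean_space) chart set \<Rightarrow> (real \<Rightarrow> 'a) \<Rightarrow> real \<Rightarrow> real \<Rightarrow> bool" where
  "piecewise_C1_curve X \<A> c \<alpha> \<beta> \<longleftrightarrow>
     \<alpha> < \<beta> \<and>
     (\<exists>(n::nat) \<tau>. \<tau> 0 = \<alpha> \<and> \<tau> n = \<beta> \<and>
        (\<forall>i<n. \<tau> i < \<tau> (Suc i) \<and> C1_curve X \<A> c (\<tau> i) (\<tau> (Suc i))))"

text \<open>By the transformation law the speed does not depend on the chart that is selected.\<close>

definition chart_at :: "('a, 'e::euclidean_space) chart set \<Rightarrow> 'a \<Rightarrow> ('a, 'e) chart" where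
  "chart_at \<A> p = (SOME c. c \<in> \<A> \<and> p \<in> fst c)"

definition curve_length ::
  "('a, 'e::euclidean_space) chart set \<Rightarrow> (('a, 'e) chart \<Rightarrow> 'a \<Rightarrow> 'e \<Rightarrow> 'e \<Rightarrow> real) \<Rightarrow>
   (real \<Rightarrow> 'a) \<Rightarrow> real \<Rightarrow> real \<Rightarrow> real" where
  "curve_length \<A> g c \<alpha> \<beta> = integral {\<alpha>..\<beta>} (\<lambda>t.
     let ch = chart_at \<A> (c t);
         v = vector_derivative (snd ch \<circ> c) (at t within {\<alpha>..\<beta>})
     in sqrt (g ch (c t) v v))"

text \<open>Meaningful for connected manifolds, where the set of lengths is nonempty for all points
  of \<open>X\<close>. The value 0 off the carrier is needed because the library's \<open>Metric_space\<close>
  asks for nonnegativity on the whole type.\<close>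

definition riemannian_dist ::
  "'a topology \<Rightarrow> ('a, 'e::euclidean_space) chart set \<Rightarrow>
   (('a, 'e) chart \<Rightarrow> 'a \<Rightarrow> 'e \<Rightarrow> 'e \<Rightarrow> real) \<Rightarrow> 'a \<Rightarrow> 'a \<Rightarrow> real" where
  "riemannian_dist X \<A> g p q =
     (if p \<in> topspace X \<and> q \<in> topspace X
      then Inf {curve_length \<A> g c \<alpha> \<beta> | c \<alpha> \<beta>.
                  piecewise_C1_curve X \<A> c \<alpha> \<beta> \<and> c \<alpha> = p \<and> c \<beta> = q}
      else 0)"

end

theory Submission
  imports Defs "HOL-Real_Asymp.Real_Asymp"
begin

text \<open>Suppose \<open>k > 1\<close>. Near a point where \<open>meas\<close> is positive, the Riemannian distance is as close as
  we like, in ratio, to a Euclidean distance in a chart, so \<open>\<gamma>\<close> becomes a curve \<open>x\<close> in a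
  finite-dimensional inner product space with \<open>\<bar>x t' - x t\<bar> \<approx> L \<bar>t' - t\<bar> powr (1 / k)\<close> for \<open>t'\<close> near
  \<open>t\<close>. How near \<open>t'\<close> has to be depends on \<open>t\<close>, but by Baire's theorem the estimate is uniform on
  some interval. By polarization, unit increments of \<open>x\<close> (at a small scale) that are \<open>M\<close> steps apart
  have inner product close to half the second difference of \<open>M powr (2 / k)\<close>, which tends to 0
  because \<open>2 / k < 2\<close>. Arbitrarily many increments are thus nearly orthonormal, contradicting the
  finite dimension.\<close>

section \<open>Relative closeness\<close>

definition rel_close :: "real \<Rightarrow> real \<Rightarrow> real \<Rightarrow> bool" where
  "rel_close \<epsilon> x y \<longleftrightarrow> \<bar>x - y\<bar> \<le> \<epsilon> * y"

lemma rel_close_iff: "rel_close \<epsilon> x y \<longleftrightarrow> (1 - \<epsilon>) * y \<le> x \<and> x \<le> (1 + \<epsilon>) * y"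
  by (auto simp: rel_close_def abs_le_iff algebra_simps)

lemma rel_close_mono: "rel_close \<epsilon> x y \<Longrightarrow> \<epsilon> \<le> \<delta> \<Longrightarrow> 0 \<le> y \<Longrightarrow> rel_close \<delta> x y"
  unfolding rel_close_def by (meson mult_right_mono order_trans)

lemma rel_close_mult_right: "rel_close \<epsilon> x y \<Longrightarrow> 0 \<le> c \<Longrightarrow> rel_close \<epsilon> (x * c) (y * c)"
  unfolding rel_close_def
  by (metis abs_mult abs_of_nonneg left_diff_distrib mult.assoc mult_right_mono)

lemma rel_close_if_common_left:
  assumes close_x: "rel_close \<epsilon> z x" and close_y: "rel_close \<epsilon> z y" and "0 \<le> y" "0 \<le> \<epsilon>" "\<epsilon> \<le> 1 / 2"
  shows "rel_close (4 * \<epsilon>) x y"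
proof -
  have eps_square: "2 * \<epsilon>\<^sup>2 \<le> \<epsilon>"
    using mult_left_mono[OF \<open>\<epsilon> \<le> 1 / 2\<close> \<open>0 \<le> \<epsilon>\<close>] by (simp add: power2_eq_square)
  have "(1 - \<epsilon>) * x \<le> (1 + \<epsilon>) * y" "(1 - \<epsilon>) * y \<le> (1 + \<epsilon>) * x"
    using close_x close_y unfolding rel_close_iff by linarith+
  moreover have "1 + \<epsilon> \<le> (1 - \<epsilon>) * (1 + 4 * \<epsilon>)" "(1 + \<epsilon>) * (1 - 4 * \<epsilon>) \<le> 1 - \<epsilon>"
    using eps_square \<open>0 \<le> \<epsilon>\<close> by (simp_all add: algebra_simps power2_eq_square)
  then have "(1 + \<epsilon>) * y \<le> (1 - \<epsilon>) * (1 + 4 * \<epsilon>) * y" "(1 + \<epsilon>) * (1 - 4 * \<epsilon>) * y \<le> (1 - \<epsilon>) * y"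
    by (auto intro: mult_right_mono \<open>0 \<le> y\<close>)
  ultimately have "(1 - \<epsilon>) * x \<le> (1 - \<epsilon>) * ((1 + 4 * \<epsilon>) * y)"
    "(1 + \<epsilon>) * ((1 - 4 * \<epsilon>) * y) \<le> (1 + \<epsilon>) * x"
    unfolding mult.assoc by linarith+
  then show ?thesis using assms(4,5) by (simp add: rel_close_iff)
qed

lemma rel_close_power2:
  assumes "rel_close \<epsilon> x y" "0 \<le> y" "0 \<le> \<epsilon>" "\<epsilon> \<le> 1"
  shows "rel_close (3 * \<epsilon>) (x\<^sup>2) (y\<^sup>2)"
proof -
  have "\<epsilon> * y \<le> 1 * y" by (intro mult_right_mono assms)
  then have "\<bar>x + y\<bar> \<le> 3 * y" using assms(1) unfolding rel_close_def by linarith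
  then have "\<bar>x - y\<bar> * \<bar>x + y\<bar> \<le> (\<epsilon> * y) * (3 * y)"
    using assms by (intro mult_mono) (auto simp: rel_close_def)
  then show ?thesis
    by (simp add: rel_close_def power2_eq_square mult_ac square_diff_square_factored flip: abs_mult)
qed

lemma rel_close_sqrt:
  assumes "rel_close \<epsilon> x y" "0 \<le> x" "0 \<le> y"
  shows "rel_close \<epsilon> (sqrt x) (sqrt y)"
proof (cases "y = 0")
  case True
  then show ?thesis using assms by (simp add: rel_close_def)
next
  case False
  have "\<bar>sqrt x - sqrt y\<bar> * sqrt y \<le> \<bar>sqrt x - sqrt y\<bar> * \<bar>sqrt x + sqrt y\<bar>"
    using assms by (intro mult_left_mono) auto
  also have "\<dots> = \<bar>x - y\<bar>"
    unfolding abs_mult[symmetric] using assms by (simp add: left_diff_distrib distrib_left)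
  also have "\<dots> \<le> \<epsilon> * sqrt y * sqrt y"
    using assms by (simp add: rel_close_def mult.assoc)
  finally show ?thesis using False \<open>0 \<le> y\<close> by (simp add: rel_close_def)
qed

section \<open>Inner product forms\<close>

definition form_norm :: "('e \<Rightarrow> 'e \<Rightarrow> real) \<Rightarrow> 'e \<Rightarrow> real" where
  "form_norm G v = sqrt (G v v)"

abbreviation form_dist :: "('e::minus \<Rightarrow> 'e \<Rightarrow> real) \<Rightarrow> 'e \<Rightarrow> 'e \<Rightarrow> real" where
  "form_dist G x y \<equiv> form_norm G (x - y)"

lemma bilinear_Basis_expansion:
  fixes B :: "'e::euclidean_space \<Rightarrow> 'e \<Rightarrow> real"
  assumes "bilinear B"
  shows "B v w = (\<Sum>i\<in>Basis. \<Sum>j\<in>Basis. (v \<bullet> i) * (w \<bullet> j) * B i j)"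
proof -
  have "B v w = B (\<Sum>i\<in>Basis. (v \<bullet> i) *\<^sub>R i) (\<Sum>j\<in>Basis. (w \<bullet> j) *\<^sub>R j)"
    by (simp add: euclidean_representation)
  also have "\<dots> = (\<Sum>i\<in>Basis. \<Sum>j\<in>Basis. B ((v \<bullet> i) *\<^sub>R i) ((w \<bullet> j) *\<^sub>R j))"
    by (subst bilinear_sum[OF assms]) (simp add: sum.cartesian_product)
  finally show ?thesis
    by (simp add: bilinear_lmul[OF assms] bilinear_rmul[OF assms] mult_ac)
qed

lemma bilinear_diff_le_if_Basis_diff_le:
  fixes B C :: "'e::euclidean_space \<Rightarrow> 'e \<Rightarrow> real"
  assumes "bilinear B" "bilinear C"
    and coeff: "\<And>i j. i \<in> Basis \<Longrightarrow> j \<in> Basis \<Longrightarrow> \<bar>B i j - C i j\<bar> \<le> \<eta>"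
  shows "\<bar>B v w - C v w\<bar> \<le> (real DIM('e))\<^sup>2 * \<eta> * (norm v * norm w)"
proof -
  have "B v w - C v w = (\<Sum>i\<in>Basis. \<Sum>j\<in>Basis. (v \<bullet> i) * (w \<bullet> j) * (B i j - C i j))"
    unfolding bilinear_Basis_expansion[OF assms(1), of v w]
      bilinear_Basis_expansion[OF assms(2), of v w]
    by (simp add: sum_subtractf right_diff_distrib)
  also have "\<bar>\<dots>\<bar> \<le> (\<Sum>i\<in>(Basis::'e set). \<Sum>j\<in>(Basis::'e set). norm v * norm w * \<eta>)"
  proof (intro order_trans[OF sum_abs] sum_mono)
    fix i j :: 'e assume "i \<in> Basis" "j \<in> Basis"
    then show "\<bar>(v \<bullet> i) * (w \<bullet> j) * (B i j - C i j)\<bar> \<le> norm v * norm w * \<eta>"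
      unfolding abs_mult by (intro mult_mono Basis_le_norm coeff) auto
  qed
  also have "\<dots> = (real DIM('e))\<^sup>2 * \<eta> * (norm v * norm w)"
    by (simp add: power2_eq_square)
  finally show ?thesis .
qed

lemma bilinear_polarization:
  fixes G :: "'e::real_vector \<Rightarrow> 'e \<Rightarrow> real"
  assumes bilinear: "bilinear G" and symmetric: "\<And>v w. G v w = G w v"
  shows "2 * G (a - b) (c - d) =
    G (a - d) (a - d) + G (b - c) (b - c) - G (a - c) (a - c) - G (b - d) (b - d)"
  using symmetric[of b a] symmetric[of c a] symmetric[of d a]
    symmetric[of c b] symmetric[of d b] symmetric[of d c]
  by (simp add: bilinear_lsub[OF bilinear] bilinear_rsub[OF bilinear])

lemma combination_eq_0_if_diagonally_dominant:
  fixes w :: "'i \<Rightarrow> 'a::real_vector" and G :: "'a \<Rightarrow> 'a \<Rightarrow> real"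
  assumes finite: "finite I" and linear: "\<And>i. i \<in> I \<Longrightarrow> linear (G (w i))"
    and dominant: "\<And>i. i \<in> I \<Longrightarrow> (\<Sum>j\<in>I - {i}. \<bar>G (w i) (w j)\<bar>) < \<bar>G (w i) (w i)\<bar>"
    and combination: "(\<Sum>i\<in>I. c i *\<^sub>R w i) = 0" and "i \<in> I"
  shows "c i = 0"
proof -
  define C where "C = Max ((\<lambda>i. \<bar>c i\<bar>) ` I)"
  have le_C: "\<bar>c j\<bar> \<le> C" if "j \<in> I" for j
    unfolding C_def using that finite by simp
  have "C \<in> (\<lambda>i. \<bar>c i\<bar>) ` I"
    unfolding C_def using finite \<open>i \<in> I\<close> by (intro Max_in) auto
  then obtain m where attained: "m \<in> I" "\<bar>c m\<bar> = C" by auto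
  have "0 = G (w m) (\<Sum>j\<in>I. c j *\<^sub>R w j)"
    using combination linear_0[OF linear[OF attained(1)]] by simp
  also have "\<dots> = (\<Sum>j\<in>I. c j * G (w m) (w j))"
    by (simp add: linear_sum[OF linear[OF attained(1)]] linear_scale[OF linear[OF attained(1)]])
  also have "\<dots> = c m * G (w m) (w m) + (\<Sum>j\<in>I - {m}. c j * G (w m) (w j))"
    by (rule sum.remove[OF finite attained(1)])
  finally have "\<bar>c m * G (w m) (w m)\<bar> = \<bar>\<Sum>j\<in>I - {m}. c j * G (w m) (w j)\<bar>"
    by linarith
  also have "\<dots> \<le> (\<Sum>j\<in>I - {m}. C * \<bar>G (w m) (w j)\<bar>)"
    by (intro order_trans[OF sum_abs] sum_mono) (auto simp: abs_mult intro!: mult_right_mono le_C)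
  also have "\<dots> = C * (\<Sum>j\<in>I - {m}. \<bar>G (w m) (w j)\<bar>)"
    by (rule sum_distrib_left[symmetric])
  finally have "C * \<bar>G (w m) (w m)\<bar> \<le> C * (\<Sum>j\<in>I - {m}. \<bar>G (w m) (w j)\<bar>)"
    by (simp add: abs_mult attained(2))
  then have "C \<le> 0" using dominant[OF attained(1)] by (simp add: mult_le_cancel_left)
  then show ?thesis using le_C[OF \<open>i \<in> I\<close>] by linarith
qed

lemma card_le_DIM_if_diagonally_dominant:
  fixes w :: "'i \<Rightarrow> 'e::euclidean_space" and G :: "'e \<Rightarrow> 'e \<Rightarrow> real"
  assumes finite: "finite I" and linear: "\<And>i. i \<in> I \<Longrightarrow> linear (G (w i))"
    and dominant: "\<And>i. i \<in> I \<Longrightarrow> (\<Sum>j\<in>I - {i}. \<bar>G (w i) (w j)\<bar>) < \<bar>G (w i) (w i)\<bar>"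
  shows "card I \<le> DIM('e)"
proof -
  have inj: "inj_on w I"
  proof (rule inj_onI, rule ccontr)
    fix i j assume equal: "i \<in> I" "j \<in> I" "w i = w j" "i \<noteq> j"
    then have "\<bar>G (w i) (w j)\<bar> \<le> (\<Sum>j\<in>I - {i}. \<bar>G (w i) (w j)\<bar>)"
      using finite by (intro member_le_sum[where f = "\<lambda>j. \<bar>G (w i) (w j)\<bar>"]) auto
    then show False using dominant[OF equal(1)] equal(3) by simp
  qed
  have "independent (w ` I)"
  proof
    assume "dependent (w ` I)"
    then obtain u where dependence: "\<exists>v\<in>w ` I. u v \<noteq> 0" "(\<Sum>v\<in>w ` I. u v *\<^sub>R v) = 0"
      using finite by (auto simp: dependent_finite)
    from dependence(2) have "(\<Sum>i\<in>I. u (w i) *\<^sub>R w i) = 0" by (simp add: sum.reindex[OF inj])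
    from combination_eq_0_if_diagonally_dominant[OF finite linear dominant this] dependence(1)
    show False by blast
  qed
  then show ?thesis using independent_bound[of "w ` I"] card_image[OF inj] by simp
qed

locale inner_form =
  fixes G :: "'e::euclidean_space \<Rightarrow> 'e \<Rightarrow> real"
  assumes bilinear: "bilinear G" and sym: "G v w = G w v" and pos: "v \<noteq> 0 \<Longrightarrow> G v v > 0"
begin

lemma bounded_bilinear: "bounded_bilinear G"
  using bilinear by (simp add: bilinear_conv_bounded_bilinear)

lemma nonneg: "G v v \<ge> 0"
  using pos[of v] bilinear_lzero[OF bilinear] by (cases "v = 0") auto

lemma form_norm_nonneg: "form_norm G v \<ge> 0"
  by (simp add: form_norm_def nonneg)

lemma form_norm_power2: "(form_norm G v)\<^sup>2 = G v v"
  by (simp add: form_norm_def nonneg)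

lemma form_norm_zero: "form_norm G 0 = 0"
  by (simp add: form_norm_def bilinear_lzero[OF bilinear])

lemma form_norm_scaleR: "form_norm G (r *\<^sub>R v) = \<bar>r\<bar> * form_norm G v"
  by (simp add: form_norm_def bilinear_lmul[OF bilinear] bilinear_rmul[OF bilinear] real_sqrt_mult
      flip: mult.assoc)

lemma form_dist_commute: "form_dist G x y = form_dist G y x"
  using form_norm_scaleR[of "-1" "x - y"] by simp

lemma Cauchy_Schwarz: "G v w \<le> form_norm G v * form_norm G w"
proof (cases "w = 0")
  case True
  then show ?thesis by (simp add: bilinear_rzero[OF bilinear] form_norm_zero)
next
  case False
  then have w_pos: "G w w > 0" by (rule pos)
  have "0 \<le> G (G w w *\<^sub>R v - G v w *\<^sub>R w) (G w w *\<^sub>R v - G v w *\<^sub>R w)" by (rule nonneg)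
  also have "\<dots> = G w w * (G v v * G w w - (G v w)\<^sup>2)"
    by (simp add: bilinear_lsub[OF bilinear] bilinear_rsub[OF bilinear] bilinear_lmul[OF bilinear]
        bilinear_rmul[OF bilinear] sym[of w v] algebra_simps power2_eq_square)
  finally have "(G v w)\<^sup>2 \<le> G v v * G w w"
    using w_pos by (simp add: zero_le_mult_iff)
  then have "G v w \<le> sqrt (G v v * G w w)" by (rule real_le_rsqrt)
  then show ?thesis by (simp add: form_norm_def real_sqrt_mult)
qed

lemma form_norm_triangle: "form_norm G (v + w) \<le> form_norm G v + form_norm G w"
proof (rule power2_le_imp_le)
  have "(form_norm G (v + w))\<^sup>2 = G v v + 2 * G v w + G w w"
    by (simp add: form_norm_power2 bilinear_ladd[OF bilinear] bilinear_radd[OF bilinear]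
        sym[of w v])
  also have "\<dots> \<le> (form_norm G v + form_norm G w)\<^sup>2"
    using Cauchy_Schwarz[of v w] by (simp add: power2_sum form_norm_power2)
  finally show "(form_norm G (v + w))\<^sup>2 \<le> (form_norm G v + form_norm G w)\<^sup>2" .
qed (simp add: form_norm_nonneg)

lemma form_dist_triangle: "form_dist G x z \<le> form_dist G x y + form_dist G y z"
  using form_norm_triangle[of "x - y" "y - z"] by simp

lemma continuous_on_form_norm:
  "continuous_on S f \<Longrightarrow> continuous_on S (\<lambda>x. form_norm G (f x))"
  unfolding form_norm_def
  by (intro continuous_intros bounded_bilinear.continuous_on[OF bounded_bilinear])

lemma ex_norm_le_form_norm:
  obtains m where "m > 0" "\<And>v. m * norm v \<le> form_norm G v"
proof -
  have "sphere (0::'e) 1 \<noteq> {}" by simp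
  then obtain v0 where minimizer: "v0 \<in> sphere 0 1"
    "\<And>v. v \<in> sphere 0 1 \<Longrightarrow> form_norm G v0 \<le> form_norm G v"
    using continuous_attains_inf[of "sphere (0::'e) 1" "form_norm G"]
      continuous_on_form_norm[OF continuous_on_id] by auto
  show thesis
  proof
    have "v0 \<noteq> 0" using minimizer(1) by auto
    then show "form_norm G v0 > 0" using pos by (simp add: form_norm_def)
    show "form_norm G v0 * norm v \<le> form_norm G v" for v
    proof (cases "v = 0")
      case False
      then have "form_norm G v0 \<le> form_norm G ((1 / norm v) *\<^sub>R v)" by (intro minimizer(2)) simp
      then show ?thesis using False by (simp add: form_norm_scaleR field_simps)
    qed (simp add: form_norm_zero)
  qed
qed

lemma form_norm_rel_close_if_Basis_close:
  assumes "\<epsilon> > 0"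
  obtains \<eta> where "\<eta> > 0" "\<And>H v. inner_form H \<Longrightarrow>
    (\<And>i j. i \<in> Basis \<Longrightarrow> j \<in> Basis \<Longrightarrow> \<bar>H i j - G i j\<bar> \<le> \<eta>) \<Longrightarrow>
    rel_close \<epsilon> (form_norm H v) (form_norm G v)"
proof -
  obtain m where m_bound: "m > 0" "\<And>v. m * norm v \<le> form_norm G v"
    using ex_norm_le_form_norm by blast
  define \<eta> where "\<eta> = \<epsilon> * m\<^sup>2 / (real DIM('e))\<^sup>2"
  show thesis
  proof
    show "\<eta> > 0" using m_bound \<open>\<epsilon> > 0\<close> by (simp add: \<eta>_def)
    fix H v assume Basis_close: "inner_form H" "\<And>i j. i \<in> Basis \<Longrightarrow> j \<in> Basis \<Longrightarrow> \<bar>H i j - G i j\<bar> \<le> \<eta>"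
    interpret H: inner_form H by (rule Basis_close)
    have "\<bar>H v v - G v v\<bar> \<le> (real DIM('e))\<^sup>2 * \<eta> * (norm v * norm v)"
      by (rule bilinear_diff_le_if_Basis_diff_le[OF H.bilinear bilinear Basis_close(2)])
    also have "\<dots> = \<epsilon> * (m * norm v)\<^sup>2" by (simp add: \<eta>_def power2_eq_square)
    also have "\<dots> \<le> \<epsilon> * (form_norm G v)\<^sup>2"
      using m_bound \<open>\<epsilon> > 0\<close> by (intro mult_left_mono power_mono) auto
    finally have "rel_close \<epsilon> (H v v) (G v v)" by (simp add: rel_close_def form_norm_power2)
    then show "rel_close \<epsilon> (form_norm H v) (form_norm G v)"
      unfolding form_norm_def by (intro rel_close_sqrt H.nonneg nonneg)
  qed
qed

lemma open_form_ball: "open {x. form_dist G x x0 < r}"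
  by (intro open_Collect_less continuous_on_form_norm continuous_intros)

lemma compact_form_cball: "compact {x. form_dist G x x0 \<le> r}"
proof -
  obtain m where m_bound: "m > 0" "\<And>v. m * norm v \<le> form_norm G v"
    using ex_norm_le_form_norm by blast
  have "closed {x. form_dist G x x0 \<le> r}"
    by (intro closed_Collect_le continuous_on_form_norm continuous_intros)
  moreover have "{x. form_dist G x x0 \<le> r} \<subseteq> cball x0 (r / m)"
    using m_bound(1) order_trans[OF m_bound(2)]
    by (auto simp: dist_norm norm_minus_commute pos_le_divide_eq mult.commute)
  then have "bounded {x. form_dist G x x0 \<le> r}" by (rule bounded_subset[OF bounded_cball])
  ultimately show ?thesis by (simp add: compact_eq_bounded_closed)
qed

lemma convex_form_cball: "convex {x. form_dist G x x0 \<le> r}"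
proof (rule convexI, clarify)
  fix x y and s t :: real
  assume in_ball: "form_dist G x x0 \<le> r" "form_dist G y x0 \<le> r"
    and weights: "0 \<le> s" "0 \<le> t" "s + t = 1"
  have "s *\<^sub>R x + t *\<^sub>R y - x0 = s *\<^sub>R (x - x0) + t *\<^sub>R (y - x0)"
    using weights(3) by (simp add: algebra_simps flip: scaleR_left.add)
  then have "form_dist G (s *\<^sub>R x + t *\<^sub>R y) x0 \<le> s * form_dist G x x0 + t * form_dist G y x0"
    using form_norm_triangle[of "s *\<^sub>R (x - x0)" "t *\<^sub>R (y - x0)"] weights(1,2)
    by (simp add: form_norm_scaleR)
  also have "\<dots> \<le> r" using in_ball weights by (intro convex_bound_le)
  finally show "form_dist G (s *\<^sub>R x + t *\<^sub>R y) x0 \<le> r" .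
qed

lemma has_integral_form_derivative:
  fixes a b :: real
  assumes "a \<le> b" and cont: "continuous_on {a..b} x" and finite: "finite F"
    and deriv: "\<And>t. t \<in> {a<..<b} - F \<Longrightarrow> (x has_vector_derivative x' t) (at t)"
  shows "((\<lambda>t. if t \<in> {a<..<b} - F then G w (x' t) else 0) has_integral G w (x b - x a)) {a..b}"
proof -
  have "((\<lambda>t. G w (x' t)) has_integral G w (x b) - G w (x a)) {a..b}"
  proof (rule fundamental_theorem_of_calculus_interior_strong[OF finite \<open>a \<le> b\<close>])
    show "((\<lambda>t. G w (x t)) has_vector_derivative G w (x' t)) (at t)" if "t \<in> {a<..<b} - F" for t
      by (rule bounded_linear.has_vector_derivative
          [OF bounded_bilinear.bounded_linear_right[OF bounded_bilinear] deriv[OF that]])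
    show "continuous_on {a..b} (\<lambda>t. G w (x t))"
      by (intro bounded_bilinear.continuous_on[OF bounded_bilinear] cont continuous_intros)
  qed
  then have "((\<lambda>t. G w (x' t)) has_integral G w (x b - x a)) {a..b}"
    by (simp add: bilinear_rsub[OF bilinear])
  then show ?thesis
    by (rule has_integral_spike_finite[of "F \<union> {a, b}", rotated 2]) (auto simp: finite)
qed

text \<open>The displacement \<open>u\<close> satisfies \<open>G u u = \<integral> G u x'\<close>, and Cauchy-Schwarz bounds the integrand.\<close>

lemma form_dist_le_integral:
  fixes a b :: real
  assumes "a \<le> b" and cont: "continuous_on {a..b} x" and finite: "finite F"
    and deriv: "\<And>t. t \<in> {a<..<b} - F \<Longrightarrow> (x has_vector_derivative x' t) (at t)"
    and integrand: "h integrable_on {a..b}" "\<And>t. t \<in> {a..b} \<Longrightarrow> 0 \<le> h t"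
    and bound: "\<And>t. t \<in> {a<..<b} - F \<Longrightarrow> form_norm G (x' t) \<le> h t"
  shows "form_dist G (x b) (x a) \<le> integral {a..b} h"
proof -
  define u where "u = x b - x a"
  let ?f = "\<lambda>t. if t \<in> {a<..<b} - F then G u (x' t) else 0"
  have "(?f has_integral G u u) {a..b}"
    unfolding u_def by (rule has_integral_form_derivative[OF \<open>a \<le> b\<close> cont finite deriv])
  moreover have "((\<lambda>t. form_norm G u * h t) has_integral form_norm G u * integral {a..b} h) {a..b}"
    using integrand(1) by (intro has_integral_mult_right integrable_integral)
  moreover have "?f t \<le> form_norm G u * h t" if "t \<in> {a..b}" for t
  proof (cases "t \<in> {a<..<b} - F")
    case True
    have "G u (x' t) \<le> form_norm G u * form_norm G (x' t)" by (rule Cauchy_Schwarz)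
    also have "\<dots> \<le> form_norm G u * h t" by (intro mult_left_mono bound True form_norm_nonneg)
    finally show ?thesis using True by simp
  next
    case False
    then show ?thesis
      using integrand(2)[OF that] by (simp only: if_False form_norm_nonneg mult_nonneg_nonneg)
  qed
  ultimately have "G u u \<le> form_norm G u * integral {a..b} h" by (rule has_integral_le)
  then have "form_norm G u * form_norm G u \<le> form_norm G u * integral {a..b} h"
    by (simp add: form_norm_power2 flip: power2_eq_square)
  then show ?thesis
    using form_norm_nonneg[of u] integral_nonneg[OF integrand]
    by (cases "form_norm G u = 0") (auto simp: u_def[symmetric])
qed

end

section \<open>Near snowflakes in Euclidean spaces\<close>

definition second_difference :: "(real \<Rightarrow> real) \<Rightarrow> real \<Rightarrow> real" where
  "second_difference f x = f (x + 1) + f (x - 1) - 2 * f x"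

lemma second_difference_powr_tendsto_0:
  fixes p :: real
  assumes "0 < p" "p < 2"
  shows "(second_difference (\<lambda>x. x powr p) \<longlongrightarrow> 0) at_top"
  unfolding second_difference_def
proof -
  consider "p = 1" | "p < 1" | "p > 1" by linarith
  then show "((\<lambda>x. (x + 1) powr p + (x - 1) powr p - 2 * x powr p) \<longlongrightarrow> 0) at_top"
  proof cases
    assume "p = 1"
    then show ?thesis by real_asymp
  next
    assume "p < 1"
    then have "p * (p - 1) < 0" using assms by (simp add: mult_pos_neg)
    with \<open>p < 1\<close> show ?thesis using assms by real_asymp
  next
    assume "p > 1"
    then have "p * (p - 1) > 0" using assms by simp
    with \<open>p > 1\<close> show ?thesis using assms by real_asymp
  qed
qed

lemma ex_second_difference_powr_less:
  fixes p \<sigma> :: real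
  assumes "0 < p" "p < 2" "0 < \<sigma>"
  obtains m :: nat where "m > 0" "\<And>x. real m \<le> x \<Longrightarrow> \<bar>second_difference (\<lambda>x. x powr p) x\<bar> < \<sigma>"
proof -
  have "\<forall>\<^sub>F x in at_top. \<bar>second_difference (\<lambda>x. x powr p) x\<bar> < \<sigma>"
    using order_tendstoD(2)[OF tendsto_rabs_zero[OF second_difference_powr_tendsto_0]] assms by simp
  then obtain x0 where beyond_x0: "\<And>x. x0 \<le> x \<Longrightarrow> \<bar>second_difference (\<lambda>x. x powr p) x\<bar> < \<sigma>"
    by (auto simp: eventually_at_top_linorder)
  have "x0 \<le> real (nat \<lceil>x0\<rceil> + 1)" by linarith
  then show thesis using beyond_x0 by (intro that[of "nat \<lceil>x0\<rceil> + 1"]) auto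
qed

context inner_form
begin

context
  fixes y :: "nat \<Rightarrow> 'e" and K p \<eta> :: real and N :: nat
  assumes pos: "0 < p" "0 < K" "0 \<le> \<eta>"
    and near: "\<And>i j. i \<le> N \<Longrightarrow> j \<le> N \<Longrightarrow>
      rel_close \<eta> (G (y i - y j) (y i - y j)) (K * \<bar>real i - real j\<bar> powr p)"
begin

lemma form_increments_close_second_difference:
  assumes "j < i" "i < N"
  shows "\<bar>2 * G (y (Suc i) - y i) (y (Suc j) - y j) -
    K * second_difference (\<lambda>x. x powr p) (real i - real j)\<bar> \<le> 4 * (\<eta> * (K * real N powr p))"
proof -
  define q where "q i j = G (y i - y j) (y i - y j)" for i j
  have near_N: "\<bar>q i j - K * \<bar>real i - real j\<bar> powr p\<bar> \<le> \<eta> * (K * real N powr p)"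
    if "i \<le> N" "j \<le> N" for i j
  proof -
    have "\<bar>real i - real j\<bar> powr p \<le> real N powr p"
      using that pos by (intro powr_mono2) auto
    then have "\<eta> * (K * \<bar>real i - real j\<bar> powr p) \<le> \<eta> * (K * real N powr p)"
      using pos by (intro mult_left_mono) auto
    with near[OF that] show ?thesis unfolding rel_close_def q_def by linarith
  qed
  define M where "M = real i - real j"
  have gaps: "\<bar>real (Suc i) - real j\<bar> = M + 1" "\<bar>real i - real (Suc j)\<bar> = M - 1"
    "\<bar>real (Suc i) - real (Suc j)\<bar> = M" "\<bar>real i - real j\<bar> = M"
    using \<open>j < i\<close> by (auto simp: M_def)
  have "2 * G (y (Suc i) - y i) (y (Suc j) - y j) =
      q (Suc i) j + q i (Suc j) - q (Suc i) (Suc j) - q i j"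
    unfolding q_def by (rule bilinear_polarization[OF bilinear sym])
  moreover have "Suc i \<le> N" "i \<le> N" "Suc j \<le> N" "j \<le> N" using assms by auto
  note near_N[OF this(1,4), unfolded gaps] near_N[OF this(2,3), unfolded gaps]
    near_N[OF this(1,3), unfolded gaps] near_N[OF this(2,4), unfolded gaps]
  ultimately show ?thesis
    unfolding second_difference_def M_def[symmetric] right_diff_distrib distrib_left by linarith
qed

context
  fixes m n :: nat and \<sigma> :: real
  assumes last_index: "n * m < N" and spacing: "m > 0"
    and second_difference: "\<And>x. real m \<le> x \<Longrightarrow> \<bar>second_difference (\<lambda>x. x powr p) x\<bar> \<le> \<sigma>"
    and tolerance: "4 * (\<eta> * real N powr p) \<le> \<sigma>"
begin

lemma spaced_index_less: "i \<le> n \<Longrightarrow> i * m < N"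
  using mult_le_mono1 last_index by (rule le_less_trans)

lemma spaced_increments_nearly_orthogonal:
  assumes "i \<le> n" "j < i"
  shows "\<bar>G (y (Suc (i * m)) - y (i * m)) (y (Suc (j * m)) - y (j * m))\<bar> \<le> K * \<sigma>"
proof -
  let ?G = "G (y (Suc (i * m)) - y (i * m)) (y (Suc (j * m)) - y (j * m))"
  define gap where "gap = real (i * m) - real (j * m)"
  have "j * m + m \<le> i * m"
    using mult_le_mono1[of "Suc j" i m] assms by simp
  then have gap: "real m \<le> gap" and "j * m < i * m" using spacing unfolding gap_def by linarith+
  then have "\<bar>2 * ?G - K * second_difference (\<lambda>x. x powr p) gap\<bar> \<le> 4 * (\<eta> * (K * real N powr p))"
    unfolding gap_def by (intro form_increments_close_second_difference spaced_index_less assms)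
  also have "\<dots> = K * (4 * (\<eta> * real N powr p))" by simp
  also have "\<dots> \<le> K * \<sigma>" using tolerance pos by (intro mult_left_mono) auto
  finally have "\<bar>2 * ?G - K * second_difference (\<lambda>x. x powr p) gap\<bar> \<le> K * \<sigma>" .
  moreover have "\<bar>K * second_difference (\<lambda>x. x powr p) gap\<bar> \<le> K * \<sigma>"
    using second_difference[OF gap] pos by (simp add: abs_mult)
  ultimately show ?thesis by linarith
qed

lemma near_snowflake_sequence_less_DIM:
  assumes "\<eta> \<le> 1 / 2" "n * \<sigma> < 1 / 2"
  shows "n < DIM('e)"
proof -
  define w where "w j = y (Suc (j * m)) - y (j * m)" for j
  have "card {..n} \<le> DIM('e)"
  proof (rule card_le_DIM_if_diagonally_dominant)
    show "linear (G (w i))" for i using bilinear by (simp add: bilinear_def)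
    fix i assume i_le: "i \<in> {..n}"
    have "\<bar>G (w i) (w j)\<bar> \<le> K * \<sigma>" if "j \<in> {..n} - {i}" for j
      using that i_le spaced_increments_nearly_orthogonal[of i j]
        spaced_increments_nearly_orthogonal[of j i] sym[of "w i" "w j"]
      by (cases "j < i") (auto simp: w_def)
    then have "(\<Sum>j\<in>{..n} - {i}. \<bar>G (w i) (w j)\<bar>) \<le> of_nat (card ({..n} - {i})) * (K * \<sigma>)"
      by (rule sum_bounded_above)
    also have "\<dots> = K * (n * \<sigma>)" using i_le by simp
    also have "\<dots> < K * (1 / 2)" using pos assms(2) by (intro mult_strict_left_mono) auto
    also have "\<dots> \<le> K * (1 - \<eta>)" using pos assms(1) by (intro mult_left_mono) auto
    also have "\<dots> \<le> G (w i) (w i)"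
      using near[of "Suc (i * m)" "i * m"] spaced_index_less[of i] i_le
      by (simp add: w_def rel_close_iff mult.commute)
    also have "\<dots> \<le> \<bar>G (w i) (w i)\<bar>" by (rule abs_ge_self)
    finally show "(\<Sum>j\<in>{..n} - {i}. \<bar>G (w i) (w j)\<bar>) < \<bar>G (w i) (w i)\<bar>" .
  qed simp
  then show ?thesis by simp
qed

end

end

lemma no_near_snowflake_sequence:
  fixes \<alpha> :: real
  assumes exponent: "0 < \<alpha>" "\<alpha> < 1"
  obtains \<epsilon> :: real and N :: nat where "\<epsilon> > 0"
    "\<And>L (y :: nat \<Rightarrow> 'e). L > 0 \<Longrightarrow>
      \<exists>i\<le>N. \<exists>j\<le>N. \<not> rel_close \<epsilon> (form_dist G (y i) (y j)) (L * \<bar>real i - real j\<bar> powr \<alpha>)"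
proof -
  define n where "n = DIM('e)"
  define \<sigma> where "\<sigma> = 1 / (2 * (real n + 1))"
  have sigma: "0 < \<sigma>" "\<sigma> \<le> 1 / 2" "n * \<sigma> < 1 / 2" by (auto simp: \<sigma>_def field_simps)
  obtain m where spacing: "m > 0" "\<And>x. real m \<le> x \<Longrightarrow> \<bar>second_difference (\<lambda>x. x powr (2 * \<alpha>)) x\<bar> < \<sigma>"
    using ex_second_difference_powr_less[of "2 * \<alpha>" \<sigma>] exponent sigma(1) by auto
  define N where "N = n * m + 1"
  define P where "P = real N powr (2 * \<alpha>)"
  have "P \<ge> 1" unfolding P_def N_def using exponent by (intro ge_one_powr_ge_zero) auto
  define \<epsilon> where "\<epsilon> = \<sigma> / (12 * P)"
  have eps: "0 < \<epsilon>" "\<epsilon> \<le> 1 / 6" "4 * (3 * \<epsilon> * P) = \<sigma>"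
    using sigma \<open>P \<ge> 1\<close> by (auto simp: \<epsilon>_def field_simps)
  show thesis
  proof (rule that[OF eps(1)], rule ccontr)
    fix L :: real and y :: "nat \<Rightarrow> 'e"
    assume "L > 0" and near: "\<not> (\<exists>i\<le>N. \<exists>j\<le>N.
      \<not> rel_close \<epsilon> (form_dist G (y i) (y j)) (L * \<bar>real i - real j\<bar> powr \<alpha>))"
    have near_squared:
      "rel_close (3 * \<epsilon>) (G (y i - y j) (y i - y j)) (L\<^sup>2 * \<bar>real i - real j\<bar> powr (2 * \<alpha>))"
      if "i \<le> N" "j \<le> N" for i j
    proof -
      have "rel_close (3 * \<epsilon>) ((form_dist G (y i) (y j))\<^sup>2) ((L * \<bar>real i - real j\<bar> powr \<alpha>)\<^sup>2)"
        using near that eps(1,2) \<open>L > 0\<close> by (intro rel_close_power2) auto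
      then show ?thesis
        by (simp add: form_norm_power2 power_mult_distrib power2_eq_square[of "_ powr _"]
            flip: powr_add)
    qed
    have "n < DIM('e)"
      by (rule near_snowflake_sequence_less_DIM[OF _ _ _ near_squared _ spacing(1)
            less_imp_le[OF spacing(2)]])
        (use exponent eps sigma(3) \<open>L > 0\<close> in \<open>auto simp: N_def P_def\<close>)
    then show False by (simp add: n_def)
  qed
qed

end

lemma closed_locally_related:
  fixes S :: "'a::metric_space set"
  assumes "closed S" and closed: "\<And>t'. t' \<in> S \<Longrightarrow> closed {t \<in> S. R t t'}"
  shows "closed {t \<in> S. \<forall>t'\<in>S. dist t' t < r \<longrightarrow> R t t'}"
proof -
  have "closed (S \<inter> {t. r \<le> dist t' t} \<union> {t \<in> S. R t t'})" if "t' \<in> S" for t'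
    by (intro closed_Un closed_Int assms closed_Collect_le continuous_intros that)
  then have "closed (S \<inter> (\<Inter>t'\<in>S. S \<inter> {t. r \<le> dist t' t} \<union> {t \<in> S. R t t'}))"
    by (intro closed_Int closed_INT ballI \<open>closed S\<close>)
  also have "S \<inter> (\<Inter>t'\<in>S. S \<inter> {t. r \<le> dist t' t} \<union> {t \<in> S. R t t'}) =
      {t \<in> S. \<forall>t'\<in>S. dist t' t < r \<longrightarrow> R t t'}"
    by (auto simp: not_less[symmetric])
  finally show ?thesis .
qed

lemma Baire_locally_uniform:
  fixes S :: "'a::complete_space set"
  assumes domain: "closed S" "interior S \<noteq> {}"
    and closed: "\<And>t'. t' \<in> S \<Longrightarrow> closed {t \<in> S. R t t'}"
    and refl: "\<And>t. t \<in> S \<Longrightarrow> R t t"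
    and eventually: "\<And>t. t \<in> S \<Longrightarrow> \<forall>\<^sub>F t' in at t within S. R t t'"
  obtains t0 e where "e > 0" "ball t0 e \<subseteq> S" "\<And>t t'. t \<in> ball t0 e \<Longrightarrow> t' \<in> ball t0 e \<Longrightarrow> R t t'"
proof -
  define E where "E n = {t \<in> S. \<forall>t'\<in>S. dist t' t < 1 / real (Suc n) \<longrightarrow> R t t'}" for n
  have "closed (E n)" for n
    unfolding E_def by (intro closed_locally_related domain closed)
  have "(\<Union>n. E n) = S"
  proof safe
    fix t assume t_mem: "t \<in> S"
    then obtain \<delta> where near_t: "\<delta> > 0" "\<And>t'. t' \<in> S \<Longrightarrow> t' \<noteq> t \<Longrightarrow> dist t' t < \<delta> \<Longrightarrow> R t t'"
      using eventually[OF t_mem] unfolding eventually_at by blast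
    obtain n where "1 / real (Suc n) < \<delta>"
      using reals_Archimedean[OF near_t(1)] by (auto simp: inverse_eq_divide)
    then have "R t t'" if "t' \<in> S" "dist t' t < 1 / real (Suc n)" for t'
      using near_t(2)[OF that(1)] refl[OF t_mem] that(2) by (cases "t' = t") auto
    then have "t \<in> E n" using t_mem by (simp add: E_def)
    then show "t \<in> (\<Union>n. E n)" by blast
  qed (auto simp: E_def)
  with domain(2) obtain n where "interior (E n) \<noteq> {}"
    using Baire_category_alt[of "euclidean :: 'a topology" "range E"] \<open>\<And>n. closed (E n)\<close>
      completely_metrizable_space_euclidean by auto
  then obtain t0 d where ball_in_E: "d > 0" "ball t0 d \<subseteq> E n" by (meson equals0I mem_interior)
  define e where "e = min d (1 / (2 * real (Suc n)))"
  show thesis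
  proof
    show "e > 0" using ball_in_E by (simp add: e_def)
    show "ball t0 e \<subseteq> S" using ball_in_E by (auto simp: e_def E_def)
    fix t t' assume in_ball: "t \<in> ball t0 e" "t' \<in> ball t0 e"
    then have "dist t' t < 2 * e" using dist_triangle3[of t' t t0] by simp
    also have "\<dots> \<le> 2 * (1 / (2 * real (Suc n)))"
      unfolding e_def by (intro mult_left_mono min.cobounded2) simp
    also have "\<dots> = 1 / real (Suc n)" by (simp del: of_nat_Suc)
    finally have "dist t' t < 1 / real (Suc n)" .
    moreover have "t \<in> E n" "t' \<in> E n" using in_ball ball_in_E(2) by (auto simp: e_def)
    ultimately show "R t t'" by (simp add: E_def)
  qed
qed

text \<open>An interval with the metric \<open>\<bar>t' - t\<bar> powr \<alpha>\<close>, \<open>\<alpha> < 1\<close>, is called a snowflake.\<close>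

definition near_snowflake ::
  "('b \<Rightarrow> 'b \<Rightarrow> real) \<Rightarrow> real \<Rightarrow> real \<Rightarrow> real \<Rightarrow> (real \<Rightarrow> 'b) \<Rightarrow> real set \<Rightarrow> bool" where
  "near_snowflake d \<alpha> L \<epsilon> x S \<longleftrightarrow>
     (\<forall>t\<in>S. \<forall>\<^sub>F t' in at t within S. rel_close \<epsilon> (d (x t') (x t)) (L * \<bar>t' - t\<bar> powr \<alpha>))"

lemma near_snowflake_transfer:
  assumes "near_snowflake d \<alpha> L \<epsilon> x S" "0 \<le> L" "0 \<le> \<epsilon>" "\<epsilon> \<le> 1 / 2"
    and "\<And>t t'. t \<in> S \<Longrightarrow> t' \<in> S \<Longrightarrow> rel_close \<epsilon> (d (x t') (x t)) (d' (x' t') (x' t))"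
    and "4 * \<epsilon> \<le> \<delta>"
  shows "near_snowflake d' \<alpha> L \<delta> x' S"
  unfolding near_snowflake_def
proof
  fix t assume t_mem: "t \<in> S"
  have "\<forall>\<^sub>F t' in at t within S. t' \<in> S" by (simp add: eventually_at_filter)
  moreover have "\<forall>\<^sub>F t' in at t within S. rel_close \<epsilon> (d (x t') (x t)) (L * \<bar>t' - t\<bar> powr \<alpha>)"
    using assms(1) t_mem by (simp add: near_snowflake_def)
  ultimately show "\<forall>\<^sub>F t' in at t within S. rel_close \<delta> (d' (x' t') (x' t)) (L * \<bar>t' - t\<bar> powr \<alpha>)"
  proof eventually_elim
    case (elim t')
    have "rel_close (4 * \<epsilon>) (d' (x' t') (x' t)) (L * \<bar>t' - t\<bar> powr \<alpha>)"
      by (rule rel_close_if_common_left[OF assms(5)[OF t_mem elim(1)] elim(2)])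
        (use assms(2-4) in auto)
    then show ?case by (rule rel_close_mono) (use \<open>4 * \<epsilon> \<le> \<delta>\<close> \<open>0 \<le> L\<close> in auto)
  qed
qed

lemma tendsto_abs_diff_powr_0:
  fixes \<alpha> t :: real
  assumes "\<alpha> > 0"
  shows "((\<lambda>t'. \<bar>t' - t\<bar> powr \<alpha>) \<longlongrightarrow> 0) (at t within S)"
proof -
  have "((\<lambda>t'. \<bar>t' - t\<bar>) \<longlongrightarrow> 0) (at t within S)" by (auto intro!: tendsto_eq_intros)
  then show ?thesis using tendsto_powr'[OF _ tendsto_const, of _ 0] assms by fastforce
qed

context inner_form
begin

lemma near_snowflake_continuous_on:
  assumes near: "near_snowflake (form_dist G) \<alpha> L \<epsilon> x S" and "0 < \<alpha>"
  shows "continuous_on S x"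
  unfolding continuous_on_def
proof
  fix t assume "t \<in> S"
  obtain m where m_bound: "m > 0" "\<And>v. m * norm v \<le> form_norm G v"
    using ex_norm_le_form_norm by blast
  have "\<forall>\<^sub>F t' in at t within S. rel_close \<epsilon> (form_dist G (x t') (x t)) (L * \<bar>t' - t\<bar> powr \<alpha>)"
    using near \<open>t \<in> S\<close> by (simp add: near_snowflake_def)
  then have "\<forall>\<^sub>F t' in at t within S. norm (x t' - x t) \<le> (1 + \<epsilon>) * L / m * \<bar>t' - t\<bar> powr \<alpha>"
  proof eventually_elim
    case (elim t')
    then have "m * norm (x t' - x t) \<le> (1 + \<epsilon>) * L * \<bar>t' - t\<bar> powr \<alpha>"
      using m_bound(2)[of "x t' - x t"] unfolding rel_close_iff by linarith
    then show ?case using m_bound(1) by (simp add: field_simps)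
  qed
  then have "((\<lambda>t'. x t' - x t) \<longlongrightarrow> 0) (at t within S)"
    by (rule Lim_null_comparison) (intro tendsto_mult_right_zero tendsto_abs_diff_powr_0 \<open>0 < \<alpha>\<close>)
  then show "(x \<longlongrightarrow> x t) (at t within S)" by (simp add: LIM_zero_iff)
qed

lemma no_near_snowflake_curve:
  fixes \<alpha> :: real
  assumes exponent: "0 < \<alpha>" "\<alpha> < 1"
  obtains \<epsilon> where "\<epsilon> > 0" "\<And>L u v x. L > 0 \<Longrightarrow> u < v \<Longrightarrow> \<not> near_snowflake (form_dist G) \<alpha> L \<epsilon> x {u..v}"
proof -
  obtain \<epsilon> N where "\<epsilon> > 0" and no_sequence: "\<And>L (y :: nat \<Rightarrow> 'e). L > 0 \<Longrightarrow>
      \<exists>i\<le>N. \<exists>j\<le>N. \<not> rel_close \<epsilon> (form_dist G (y i) (y j)) (L * \<bar>real i - real j\<bar> powr \<alpha>)"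
    using no_near_snowflake_sequence[OF exponent] by blast
  show thesis
  proof (rule that[OF \<open>\<epsilon> > 0\<close>], rule notI)
    fix L u v :: real and x
    assume "L > 0" "u < v" and near: "near_snowflake (form_dist G) \<alpha> L \<epsilon> x {u..v}"
    have cont: "continuous_on {u..v} x" by (rule near_snowflake_continuous_on[OF near exponent(1)])
    let ?R = "\<lambda>t t'. rel_close \<epsilon> (form_dist G (x t') (x t)) (L * \<bar>t' - t\<bar> powr \<alpha>)"
    have "closed {t \<in> {u..v}. ?R t t'}" for t'
      unfolding rel_close_def
      by (intro continuous_on_closed_Collect_le continuous_intros continuous_on_form_norm cont
          continuous_on_powr') (use exponent in auto)
    moreover have "?R t t" for t by (simp add: form_norm_zero rel_close_def)
    moreover have "interior {u..v} \<noteq> {}" using \<open>u < v\<close> by simp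
    ultimately obtain t0 e where uniform: "e > 0" "\<And>t t'. t \<in> ball t0 e \<Longrightarrow> t' \<in> ball t0 e \<Longrightarrow> ?R t t'"
      using near unfolding near_snowflake_def
      by (elim Baire_locally_uniform[of "{u..v}" ?R, rotated]) auto
    define h where "h = e / (real N + 1)"
    have step: "h > 0" "h * (real N + 1) = e" using uniform(1) by (simp_all add: h_def)
    have "t0 + h * real i \<in> ball t0 e" if "i \<le> N" for i
    proof -
      have "h * real i < h * (real N + 1)" using that step by (intro mult_strict_left_mono) auto
      then show ?thesis using step by (simp add: dist_real_def)
    qed
    then have "?R (t0 + h * real j) (t0 + h * real i)" if "i \<le> N" "j \<le> N" for i j
      using uniform(2) that by blast
    moreover have "\<bar>(t0 + h * real i) - (t0 + h * real j)\<bar> powr \<alpha> =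
        h powr \<alpha> * \<bar>real i - real j\<bar> powr \<alpha>" for i j
      using step by (simp add: abs_mult powr_mult flip: right_diff_distrib)
    ultimately show False
      using no_sequence[of "L * h powr \<alpha>" "\<lambda>i. x (t0 + h * real i)"] \<open>L > 0\<close> step
      by (auto simp: mult.assoc)
  qed
qed

end

section \<open>Charts and curves\<close>

lemma connected_space_induct:
  assumes "connected_space X" "p \<in> topspace X" "q \<in> topspace X" "P p"
    and local: "\<And>x. x \<in> topspace X \<Longrightarrow>
      \<exists>W. openin X W \<and> x \<in> W \<and> (\<forall>y\<in>W. \<forall>z\<in>W. P y \<longrightarrow> P z)"
  shows "P q"
proof -
  have "openin X {x \<in> topspace X. Q (P x)}" for Q :: "bool \<Rightarrow> bool"
  proof (subst openin_subopen, clarify)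
    fix x assume x_mem: "x \<in> topspace X" "Q (P x)"
    then obtain W where nbhd: "openin X W" "x \<in> W" "\<forall>y\<in>W. \<forall>z\<in>W. P y \<longrightarrow> P z"
      using local[OF x_mem(1)] by blast
    have "y \<in> {x \<in> topspace X. Q (P x)}" if "y \<in> W" for y
    proof -
      have "P y = P x" using nbhd that by blast
      then show ?thesis using openin_subset[OF nbhd(1)] that x_mem(2) by auto
    qed
    with nbhd(1,2) show "\<exists>T. openin X T \<and> x \<in> T \<and> T \<subseteq> {x \<in> topspace X. Q (P x)}"
      by (intro exI[of _ W] conjI subsetI)
  qed
  from this[of "\<lambda>b. b"] this[of Not] show ?thesis
    using assms(1-4) unfolding connected_space_def by blast
qed

lemma last_exit_time:
  fixes \<alpha> \<beta> :: real
  assumes curve: "continuous_map (top_of_set {\<alpha>..\<beta>}) X c" and "\<alpha> \<le> \<beta>"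
    and open_V: "openin X V" "c \<beta> \<in> V"
  obtains T where "T \<in> {\<alpha>..\<beta>}" "\<And>t. t \<in> {T..\<beta>} \<Longrightarrow> c t \<in> X closure_of V" "T = \<alpha> \<or> c T \<notin> V"
proof -
  have V_sub: "V \<subseteq> X closure_of V" by (intro closure_of_subset openin_subset open_V)
  define Z where "Z = {t \<in> {\<alpha>..\<beta>}. c t \<notin> V}"
  show thesis
  proof (cases "Z = {}")
    case True
    then show thesis using that[of \<alpha>] V_sub \<open>\<alpha> \<le> \<beta>\<close> by (auto simp: Z_def)
  next
    case False
    have "openin (top_of_set {\<alpha>..\<beta>}) {t \<in> {\<alpha>..\<beta>}. c t \<in> V}"
      using openin_continuous_map_preimage[OF curve open_V(1)] by simp
    from closedin_diff[OF closedin_topspace this] have "closed Z"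
      by (auto intro: closedin_closed_trans simp: Z_def set_diff_eq conj_commute cong: conj_cong)
    define T where "T = Sup Z"
    have bounded: "bdd_above Z" by (rule bdd_aboveI[of _ \<beta>]) (auto simp: Z_def)
    have "T \<in> Z" unfolding T_def by (rule closed_contains_Sup[OF False bounded \<open>closed Z\<close>])
    then have exit_time: "\<alpha> \<le> T" "T < \<beta>" "c T \<notin> V" using open_V(2) by (auto simp: Z_def less_le)
    have "c t \<in> V" if "t \<in> {T<..\<beta>}" for t
      using that exit_time cSup_upper[OF _ bounded, of t] by (force simp: Z_def T_def)
    then have after: "{T<..\<beta>} \<subseteq> {t \<in> {\<alpha>..\<beta>}. c t \<in> X closure_of V}" using V_sub exit_time(1) by auto
    have "closedin (top_of_set {\<alpha>..\<beta>}) {t \<in> {\<alpha>..\<beta>}. c t \<in> X closure_of V}"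
      using closedin_continuous_map_preimage[OF curve closedin_closure_of[of X V]] by simp
    then have "closed {t \<in> {\<alpha>..\<beta>}. c t \<in> X closure_of V}" by (rule closedin_closed_trans) simp
    from closure_minimal[OF after this] have "{T..\<beta>} \<subseteq> {t \<in> {\<alpha>..\<beta>}. c t \<in> X closure_of V}"
      using exit_time(2) by simp
    then show thesis using that[of T] exit_time by force
  qed
qed

lemma curve_preimage_ball:
  fixes c :: "'b::metric_space \<Rightarrow> 'a"
  assumes "continuous_map (top_of_set S) X c" "openin X U" "t \<in> S" "c t \<in> U"
  obtains \<delta> where "\<delta> > 0" "\<And>s. s \<in> S \<Longrightarrow> dist s t < \<delta> \<Longrightarrow> c s \<in> U"
proof -
  have "openin (top_of_set S) {s \<in> S. c s \<in> U}"
    using openin_continuous_map_preimage[OF assms(1,2)] by simp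
  then show thesis using that assms(3,4)
    by (auto simp: openin_euclidean_subtopology_iff)
qed

lemma continuous_map_Icc_combine:
  fixes a b b' :: real
  assumes "continuous_map (top_of_set {a..b}) X c" "continuous_map (top_of_set {b..b'}) X c"
    and "a \<le> b" "b \<le> b'"
  shows "continuous_map (top_of_set {a..b'}) X c"
proof -
  have "continuous_map (top_of_set {a..b'}) X (\<lambda>t. if t \<le> b then c t else c t)"
  proof (rule continuous_map_cases_le)
    have "{t \<in> {a..b'}. t \<le> b} = {a..b}" "{t \<in> {a..b'}. b \<le> t} = {b..b'}"
      using assms(3,4) by auto
    then show
      "continuous_map
        (subtopology (top_of_set {a..b'}) {t \<in> topspace (top_of_set {a..b'}). t \<le> b}) X c"
      "continuous_map
        (subtopology (top_of_set {a..b'}) {t \<in> topspace (top_of_set {a..b'}). b \<le> t}) X c"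
      using assms by (auto simp: subtopology_subtopology Int_absorb1)
  qed auto
  then show ?thesis by simp
qed

lemma C1_curve_continuous_map:
  "C1_curve X \<A> c \<alpha> \<beta> \<Longrightarrow> continuous_map (top_of_set {\<alpha>..\<beta>}) X c"
  by (simp add: C1_curve_def)

lemma C1_curve_derivative:
  assumes "C1_curve X \<A> c \<alpha> \<beta>" "(U, \<phi>) \<in> \<A>"
  obtains D where "continuous_on ({\<alpha>..\<beta>} \<inter> c -` U) D"
    "\<And>t. t \<in> {\<alpha>..\<beta>} \<Longrightarrow> c t \<in> U \<Longrightarrow> ((\<phi> \<circ> c) has_vector_derivative D t) (at t within {\<alpha>..\<beta>})"
  using assms unfolding C1_curve_def by blast

lemma C1_curve_cong:
  assumes "C1_curve X \<A> c \<alpha> \<beta>" and agree: "\<And>t. t \<in> {\<alpha>..\<beta>} \<Longrightarrow> c' t = c t"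
  shows "C1_curve X \<A> c' \<alpha> \<beta>"
  unfolding C1_curve_def
proof (intro conjI ballI; clarify?)
  show "continuous_map (top_of_set {\<alpha>..\<beta>}) X c'"
    by (rule continuous_map_eq[OF C1_curve_continuous_map[OF assms(1)]]) (simp add: agree)
next
  fix U \<phi> assume "(U, \<phi>) \<in> \<A>"
  then obtain D where deriv: "continuous_on ({\<alpha>..\<beta>} \<inter> c -` U) D"
    "\<And>t. t \<in> {\<alpha>..\<beta>} \<Longrightarrow> c t \<in> U \<Longrightarrow> ((\<phi> \<circ> c) has_vector_derivative D t) (at t within {\<alpha>..\<beta>})"
    using C1_curve_derivative[OF assms(1)] by blast
  have "{\<alpha>..\<beta>} \<inter> c' -` U = {\<alpha>..\<beta>} \<inter> c -` U" using agree by auto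
  moreover have "((\<phi> \<circ> c') has_vector_derivative D t) (at t within {\<alpha>..\<beta>})"
    if "t \<in> {\<alpha>..\<beta>} \<inter> c -` U" for t
    by (rule has_vector_derivative_transform[OF _ _ deriv(2)]) (use that agree in auto)
  ultimately show "\<exists>D. continuous_on ({\<alpha>..\<beta>} \<inter> c' -` U) D \<and>
    (\<forall>t\<in>{\<alpha>..\<beta>} \<inter> c' -` U. ((\<phi> \<circ> c') has_vector_derivative D t) (at t within {\<alpha>..\<beta>}))"
    using deriv(1) by auto
qed

lemma piecewise_C1_curve_if_C1_curve:
  assumes "C1_curve X \<A> c \<alpha> \<beta>" "\<alpha> < \<beta>"
  shows "piecewise_C1_curve X \<A> c \<alpha> \<beta>"
  unfolding piecewise_C1_curve_def
  by (intro conjI exI[of _ "1::nat"] exI[of _ "\<lambda>i::nat. if i = 0 then \<alpha> else \<beta>"])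
    (use assms in auto)

lemma piecewise_C1_curve_extend:
  assumes "piecewise_C1_curve X \<A> c \<alpha> \<beta>" "C1_curve X \<A> c \<beta> \<beta>'" "\<beta> < \<beta>'"
  shows "piecewise_C1_curve X \<A> c \<alpha> \<beta>'"
proof -
  obtain n \<tau> where "\<alpha> < \<beta>" and partition: "\<tau> 0 = \<alpha>" "\<tau> n = \<beta>"
    "\<forall>i<n. \<tau> i < \<tau> (Suc i) \<and> C1_curve X \<A> c (\<tau> i) (\<tau> (Suc i))"
    using assms(1) unfolding piecewise_C1_curve_def by blast
  let ?\<tau> = "\<tau>(Suc n := \<beta>')"
  have "?\<tau> 0 = \<alpha>" "?\<tau> (Suc n) = \<beta>'"
    "\<forall>i<Suc n. ?\<tau> i < ?\<tau> (Suc i) \<and> C1_curve X \<A> c (?\<tau> i) (?\<tau> (Suc i))"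
    using partition assms(2,3) by (auto simp: less_Suc_eq)
  moreover have "\<alpha> < \<beta>'" using \<open>\<alpha> < \<beta>\<close> \<open>\<beta> < \<beta>'\<close> by simp
  ultimately show ?thesis unfolding piecewise_C1_curve_def by blast
qed

lemma piecewise_C1_curve_induct [consumes 1, case_names C1 extend]:
  assumes "piecewise_C1_curve X \<A> c \<alpha> \<beta>"
    and C1: "\<And>\<beta>. \<alpha> < \<beta> \<Longrightarrow> C1_curve X \<A> c \<alpha> \<beta> \<Longrightarrow> P \<beta>"
    and extend: "\<And>\<beta> \<beta>'. piecewise_C1_curve X \<A> c \<alpha> \<beta> \<Longrightarrow> P \<beta> \<Longrightarrow>
      \<beta> < \<beta>' \<Longrightarrow> C1_curve X \<A> c \<beta> \<beta>' \<Longrightarrow> P \<beta>'"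
  shows "P \<beta>"
proof -
  obtain n \<tau> where "\<alpha> < \<beta>" and endpoints: "\<tau> 0 = \<alpha>" "\<tau> n = \<beta>"
    and pieces: "\<And>i. i < n \<Longrightarrow> \<tau> i < \<tau> (Suc i) \<and> C1_curve X \<A> c (\<tau> i) (\<tau> (Suc i))"
    using assms(1) unfolding piecewise_C1_curve_def by blast
  have "piecewise_C1_curve X \<A> c \<alpha> (\<tau> (Suc i)) \<and> P (\<tau> (Suc i))" if "Suc i \<le> n" for i
    using that
  proof (induction i)
    case 0
    then show ?case
      using pieces[of 0] C1 by (auto simp: endpoints intro: piecewise_C1_curve_if_C1_curve)
  next
    case (Suc i)
    then show ?case using pieces[of "Suc i"] extend by (auto intro: piecewise_C1_curve_extend)
  qed
  from this[of "n - 1"] show ?thesis using endpoints \<open>\<alpha> < \<beta>\<close> by (cases n) auto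
qed

lemma piecewise_C1_curve_less: "piecewise_C1_curve X \<A> c \<alpha> \<beta> \<Longrightarrow> \<alpha> < \<beta>"
  by (simp add: piecewise_C1_curve_def)

lemma piecewise_C1_curve_cong:
  assumes "piecewise_C1_curve X \<A> c \<alpha> \<beta>" and "\<And>t. t \<in> {\<alpha>..\<beta>} \<Longrightarrow> c' t = c t"
  shows "piecewise_C1_curve X \<A> c' \<alpha> \<beta>"
  using assms
proof (induction rule: piecewise_C1_curve_induct)
  case (C1 \<beta>)
  from C1_curve_cong[OF C1(2,3)] \<open>\<alpha> < \<beta>\<close> show ?case by (intro piecewise_C1_curve_if_C1_curve) auto
next
  case (extend \<beta> \<beta>')
  have "\<alpha> < \<beta>" using extend(1) by (rule piecewise_C1_curve_less)
  show ?case
  proof (rule piecewise_C1_curve_extend)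
    show "piecewise_C1_curve X \<A> c' \<alpha> \<beta>" using extend.hyps(2) extend.prems by (intro extend.IH) auto
    show "C1_curve X \<A> c' \<beta> \<beta>'"
      by (rule C1_curve_cong[OF extend.hyps(3)]) (use extend.prems \<open>\<alpha> < \<beta>\<close> in auto)
  qed (rule extend.hyps(2))
qed

lemma piecewise_C1_curve_append:
  assumes curve: "piecewise_C1_curve X \<A> c \<alpha> \<beta>" and piece: "C1_curve X \<A> c' \<beta> \<beta>'"
    and "\<beta> < \<beta>'" "c' \<beta> = c \<beta>"
  shows "piecewise_C1_curve X \<A> (\<lambda>t. if t \<le> \<beta> then c t else c' t) \<alpha> \<beta>'"
proof (rule piecewise_C1_curve_extend)
  show "piecewise_C1_curve X \<A> (\<lambda>t. if t \<le> \<beta> then c t else c' t) \<alpha> \<beta>"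
    by (rule piecewise_C1_curve_cong[OF curve]) simp
  show "C1_curve X \<A> (\<lambda>t. if t \<le> \<beta> then c t else c' t) \<beta> \<beta>'"
    by (rule C1_curve_cong[OF piece]) (use \<open>c' \<beta> = c \<beta>\<close> in auto)
qed fact

lemma piecewise_C1_curve_continuous_map:
  "piecewise_C1_curve X \<A> c \<alpha> \<beta> \<Longrightarrow> continuous_map (top_of_set {\<alpha>..\<beta>}) X c"
proof (induction rule: piecewise_C1_curve_induct)
  case (extend \<beta> \<beta>')
  show ?case
    by (rule continuous_map_Icc_combine[OF extend.IH C1_curve_continuous_map[OF extend.hyps(3)]])
      (use extend.hyps piecewise_C1_curve_less[OF extend.hyps(1)] in auto)
qed (rule C1_curve_continuous_map)

lemma piecewise_C1_curve_in_topspace: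
  "piecewise_C1_curve X \<A> c \<alpha> \<beta> \<Longrightarrow> t \<in> {\<alpha>..\<beta>} \<Longrightarrow> c t \<in> topspace X"
  using piecewise_C1_curve_continuous_map by (fastforce simp: continuous_map_def)

lemma piecewise_C1_curve_differentiable:
  assumes "piecewise_C1_curve X \<A> c \<alpha> \<beta>"
  obtains F where "finite F"
    "\<And>t U \<phi>. t \<in> {\<alpha>..\<beta>} - F \<Longrightarrow> (U, \<phi>) \<in> \<A> \<Longrightarrow> c t \<in> U \<Longrightarrow>
      \<exists>v. ((\<phi> \<circ> c) has_vector_derivative v) (at t)"
proof -
  define regular where
    "regular t \<longleftrightarrow> (\<forall>(U, \<phi>)\<in>\<A>. c t \<in> U \<longrightarrow> (\<exists>v. ((\<phi> \<circ> c) has_vector_derivative v) (at t)))" for t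
  have piece: "regular t" if curve: "C1_curve X \<A> c u v" and t_mem: "t \<in> {u<..<v}" for u v t
    unfolding regular_def
  proof clarify
    fix U \<phi> assume "(U, \<phi>) \<in> \<A>" "c t \<in> U"
    moreover have "t \<in> {u..v}" using t_mem by simp
    ultimately obtain w where "((\<phi> \<circ> c) has_vector_derivative w) (at t within {u..v})"
      using C1_curve_derivative[OF curve] by metis
    moreover have "at t within {u..v} = at t" using t_mem by (intro at_within_interior) simp
    ultimately show "\<exists>w. ((\<phi> \<circ> c) has_vector_derivative w) (at t)" by auto
  qed
  have "\<exists>F. finite F \<and> (\<forall>t\<in>{\<alpha>..\<beta>} - F. regular t)"
    using assms
  proof (induction rule: piecewise_C1_curve_induct)
    case (C1 \<beta>)
    then show ?case using piece[OF C1(2)] by (intro exI[of _ "{\<alpha>, \<beta>}"]) auto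
  next
    case (extend \<beta> \<beta>')
    then obtain F where exceptional: "finite F" "\<forall>t\<in>{\<alpha>..\<beta>} - F. regular t" by blast
    have "regular t" if "t \<in> {\<alpha>..\<beta>'} - (F \<union> {\<beta>, \<beta>'})" for t
      using that exceptional(2) piece[OF extend.hyps(3), of t] by (cases "t \<le> \<beta>") auto
    then show ?case using exceptional(1) by (intro exI[of _ "F \<union> {\<beta>, \<beta>'}"]) simp
  qed
  then obtain F where "finite F" "\<forall>t\<in>{\<alpha>..\<beta>} - F. regular t" by blast
  then show thesis unfolding regular_def by (intro that) auto
qed

context smooth_manifold
begin

lemma chart_domain_subset: "(U, \<phi>) \<in> \<A> \<Longrightarrow> U \<subseteq> topspace X"
  using chart_domain openin_subset by blast

lemma chart_inj: "(U, \<phi>) \<in> \<A> \<Longrightarrow> inj_on \<phi> U"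
  using homeomorphic_imp_injective_map[OF chart_homeo] chart_domain_subset
  by (metis topspace_subtopology_subset)

lemma chart_continuous: "(U, \<phi>) \<in> \<A> \<Longrightarrow> continuous_map (subtopology X U) euclidean \<phi>"
  using homeomorphic_imp_continuous_map[OF chart_homeo] continuous_map_in_subtopology by blast

lemma chart_comp_continuous_on:
  assumes "(U, \<phi>) \<in> \<A>" "continuous_map (top_of_set S) X c" "\<And>t. t \<in> S \<Longrightarrow> c t \<in> U"
  shows "continuous_on S (\<phi> \<circ> c)"
proof -
  have "continuous_map (top_of_set S) (subtopology X U) c"
    using assms(2,3) by (auto simp: continuous_map_in_subtopology)
  from continuous_map_compose[OF this chart_continuous[OF assms(1)]] show ?thesis by simp
qed

lemma chart_inverse_continuous:
  assumes "(U, \<phi>) \<in> \<A>"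
  shows "continuous_map (top_of_set (\<phi> ` U)) X (inv_into U \<phi>)"
proof -
  obtain f where inverse: "homeomorphic_maps (subtopology X U) (top_of_set (\<phi> ` U)) \<phi> f"
    using chart_homeo[OF assms] homeomorphic_map_maps by blast
  have domain: "topspace (subtopology X U) = U"
    using chart_domain_subset[OF assms] by (rule topspace_subtopology_subset)
  have "continuous_map (top_of_set (\<phi> ` U)) X f"
    using inverse unfolding homeomorphic_maps_def continuous_map_in_subtopology by blast
  then show ?thesis
  proof (rule continuous_map_eq)
    fix x assume "x \<in> topspace (top_of_set (\<phi> ` U))"
    then obtain p where p_eq: "p \<in> U" "x = \<phi> p" by auto
    then have "f x = p" using inverse domain unfolding homeomorphic_maps_def by auto
    then show "f x = inv_into U \<phi> x" using p_eq chart_inj[OF assms] by simp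
  qed
qed

lemma openin_chart_preimage:
  assumes "(U, \<phi>) \<in> \<A>" "open W"
  shows "openin X {p \<in> U. \<phi> p \<in> W}"
proof -
  have "openin (subtopology X U) {p \<in> topspace (subtopology X U). \<phi> p \<in> W}"
    using openin_continuous_map_preimage[OF chart_continuous[OF assms(1)]] assms(2) by simp
  then show ?thesis
    using chart_domain[OF assms(1)] chart_domain_subset[OF assms(1)] openin_trans_full
    by (metis topspace_subtopology_subset)
qed

lemma closedin_chart_preimage_compact:
  assumes "(U, \<phi>) \<in> \<A>" "compact K" "K \<subseteq> \<phi> ` U"
  shows "closedin X {p \<in> U. \<phi> p \<in> K}"
proof -
  have "compactin (top_of_set (\<phi> ` U)) K"
    using assms(2,3) by (simp add: compactin_subtopology)
  then have "compactin X (inv_into U \<phi> ` K)"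
    using image_compactin chart_inverse_continuous[OF assms(1)] by blast
  moreover have "inv_into U \<phi> ` K = {p \<in> U. \<phi> p \<in> K}"
  proof
    show "inv_into U \<phi> ` K \<subseteq> {p \<in> U. \<phi> p \<in> K}"
      using assms(3) by (auto simp: inv_into_into f_inv_into_f subset_iff)
    show "{p \<in> U. \<phi> p \<in> K} \<subseteq> inv_into U \<phi> ` K"
      using chart_inj[OF assms(1)] by (force simp: image_iff)
  qed
  ultimately show ?thesis using compactin_imp_closedin[OF Hausdorff] by simp
qed

lemma ex_chart:
  assumes "p \<in> topspace X"
  obtains U \<phi> where "(U, \<phi>) \<in> \<A>" "p \<in> U"
  using assms charts_cover by blast

lemma chart_at_in_atlas:
  assumes "p \<in> topspace X"
  shows "chart_at \<A> p \<in> \<A>" "p \<in> fst (chart_at \<A> p)"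
proof -
  obtain U \<phi> where "(U, \<phi>) \<in> \<A>" "p \<in> U" using ex_chart[OF assms] .
  then have "\<exists>c. c \<in> \<A> \<and> p \<in> fst c" by force
  from someI_ex[OF this] show "chart_at \<A> p \<in> \<A>" "p \<in> fst (chart_at \<A> p)"
    unfolding chart_at_def by auto
qed

lemma transition_Ck_on:
  "(U, \<phi>) \<in> \<A> \<Longrightarrow> (V, \<psi>) \<in> \<A> \<Longrightarrow> Ck_on n (\<phi> ` (U \<inter> V)) (transition (U, \<phi>) (V, \<psi>))"
  using smooth_transition unfolding smooth_on_def by blast

lemma transition_has_derivative:
  assumes "(U, \<phi>) \<in> \<A>" "(V, \<psi>) \<in> \<A>" "p \<in> U \<inter> V"
  shows "(transition (U, \<phi>) (V, \<psi>) has_derivative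
    frechet_derivative (transition (U, \<phi>) (V, \<psi>)) (at (\<phi> p))) (at (\<phi> p))"
  using transition_Ck_on[OF assms(1,2), of 1] assms(3) by (simp add: frechet_derivative_works)

lemma transition_derivative_continuous_on:
  assumes "(U, \<phi>) \<in> \<A>" "(V, \<psi>) \<in> \<A>"
    and base: "continuous_on S x" "x ` S \<subseteq> \<phi> ` (U \<inter> V)" and vector: "continuous_on S v"
  shows "continuous_on S (\<lambda>s. frechet_derivative (transition (U, \<phi>) (V, \<psi>)) (at (x s)) (v s))"
proof -
  let ?D = "\<lambda>s. frechet_derivative (transition (U, \<phi>) (V, \<psi>)) (at (x s))"
  have "continuous_on S (\<lambda>s. ?D s i)" for i
    by (rule continuous_on_compose2[OF _ base]) (use transition_Ck_on[OF assms(1,2), of 1] in simp)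
  then have "continuous_on S (\<lambda>s. \<Sum>i\<in>Basis. (v s \<bullet> i) *\<^sub>R ?D s i)"
    by (intro continuous_intros vector)
  then show ?thesis
  proof (rule continuous_on_eq)
    fix s assume "s \<in> S"
    then obtain p where "p \<in> U \<inter> V" "x s = \<phi> p" using base(2) by blast
    then have "linear (?D s)"
      using transition_has_derivative[OF assms(1,2)] has_derivative_linear by metis
    then have "?D s (\<Sum>i\<in>Basis. (v s \<bullet> i) *\<^sub>R i) = (\<Sum>i\<in>Basis. (v s \<bullet> i) *\<^sub>R ?D s i)"
      by (simp add: linear_sum linear_scale)
    then show "(\<Sum>i\<in>Basis. (v s \<bullet> i) *\<^sub>R ?D s i) = ?D s (v s)"
      by (simp add: euclidean_representation)
  qed
qed

lemma transition_chart:
  assumes "(U, \<phi>) \<in> \<A>" "p \<in> U"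
  shows "transition (U, \<phi>) (V, \<psi>) (\<phi> p) = \<psi> p"
  using assms chart_inj[OF assms(1)] by (simp add: transition_def)

lemma curve_derivative_change_chart:
  assumes curve: "continuous_map (top_of_set S) X c" and t_mem: "t \<in> S" "c t \<in> U \<inter> V"
    and charts: "(U, \<phi>) \<in> \<A>" "(V, \<psi>) \<in> \<A>"
    and deriv: "((\<phi> \<circ> c) has_vector_derivative v) (at t within S)"
  shows "((\<psi> \<circ> c) has_vector_derivative
    frechet_derivative (transition (U, \<phi>) (V, \<psi>)) (at (\<phi> (c t))) v) (at t within S)"
proof -
  obtain \<delta> where stays_in_U: "\<delta> > 0" "\<And>s. s \<in> S \<Longrightarrow> dist s t < \<delta> \<Longrightarrow> c s \<in> U"
    using curve_preimage_ball[OF curve chart_domain[OF charts(1)] t_mem(1)] t_mem(2) by blast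
  have "((transition (U, \<phi>) (V, \<psi>) \<circ> (\<phi> \<circ> c)) has_vector_derivative
    frechet_derivative (transition (U, \<phi>) (V, \<psi>)) (at (\<phi> (c t))) v) (at t within S)"
    using transition_has_derivative[OF charts t_mem(2)]
    by (intro vector_derivative_diff_chain_within[OF deriv]) (simp add: has_derivative_at_withinI)
  then show ?thesis
    by (rule has_vector_derivative_transform_within[OF _ stays_in_U(1) t_mem(1)])
      (use stays_in_U(2) transition_chart[OF charts(1)] in auto)
qed

lemma C1_curve_if_C1_in_chart:
  assumes chart: "(U, \<phi>) \<in> \<A>" and curve: "continuous_map (top_of_set {\<alpha>..\<beta>}) X c"
    and in_U: "\<And>t. t \<in> {\<alpha>..\<beta>} \<Longrightarrow> c t \<in> U"
    and deriv: "continuous_on {\<alpha>..\<beta>} D"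
      "\<And>t. t \<in> {\<alpha>..\<beta>} \<Longrightarrow> ((\<phi> \<circ> c) has_vector_derivative D t) (at t within {\<alpha>..\<beta>})"
  shows "C1_curve X \<A> c \<alpha> \<beta>"
  unfolding C1_curve_def
proof (intro conjI curve ballI, clarify)
  fix V \<psi> assume other_chart: "(V, \<psi>) \<in> \<A>"
  let ?S = "{\<alpha>..\<beta>} \<inter> c -` V"
  let ?D = "\<lambda>t. frechet_derivative (transition (U, \<phi>) (V, \<psi>)) (at ((\<phi> \<circ> c) t)) (D t)"
  have "continuous_on ?S ?D"
  proof (rule transition_derivative_continuous_on[OF chart other_chart])
    have "continuous_on {\<alpha>..\<beta>} (\<phi> \<circ> c)" by (rule chart_comp_continuous_on[OF chart curve in_U])
    then show "continuous_on ?S (\<phi> \<circ> c)" by (rule continuous_on_subset) simp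
    show "continuous_on ?S D" using deriv(1) by (rule continuous_on_subset) simp
  qed (use in_U in auto)
  moreover have "((\<psi> \<circ> c) has_vector_derivative ?D t) (at t within {\<alpha>..\<beta>})" if "t \<in> ?S" for t
    using curve_derivative_change_chart[OF curve _ _ chart other_chart deriv(2), of t] in_U that
    by simp
  ultimately show "\<exists>D. continuous_on ?S D \<and>
    (\<forall>t\<in>?S. ((\<psi> \<circ> c) has_vector_derivative D t) (at t within {\<alpha>..\<beta>}))"
    by blast
qed

end

definition chart_segment ::
  "'a set \<Rightarrow> ('a \<Rightarrow> 'e::euclidean_space) \<Rightarrow> 'a \<Rightarrow> 'a \<Rightarrow> real \<Rightarrow> real \<Rightarrow> 'a" where
  "chart_segment U \<phi> p q \<alpha> t = inv_into U \<phi> (\<phi> p + (t - \<alpha>) *\<^sub>R (\<phi> q - \<phi> p))"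

lemma chart_segment_in_chart:
  assumes "closed_segment (\<phi> p) (\<phi> q) \<subseteq> \<phi> ` U" "t \<in> {\<alpha>..\<alpha> + 1}"
  shows "chart_segment U \<phi> p q \<alpha> t \<in> U"
    and "\<phi> (chart_segment U \<phi> p q \<alpha> t) = \<phi> p + (t - \<alpha>) *\<^sub>R (\<phi> q - \<phi> p)"
    and "\<phi> (chart_segment U \<phi> p q \<alpha> t) \<in> closed_segment (\<phi> p) (\<phi> q)"
proof -
  have on_segment: "\<phi> p + (t - \<alpha>) *\<^sub>R (\<phi> q - \<phi> p) \<in> closed_segment (\<phi> p) (\<phi> q)"
    unfolding closed_segment_def using assms(2)
    by (intro CollectI exI[of _ "t - \<alpha>"]) (auto simp: algebra_simps)
  with assms(1) have "\<phi> p + (t - \<alpha>) *\<^sub>R (\<phi> q - \<phi> p) \<in> \<phi> ` U" by blast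
  then show "chart_segment U \<phi> p q \<alpha> t \<in> U"
    and "\<phi> (chart_segment U \<phi> p q \<alpha> t) = \<phi> p + (t - \<alpha>) *\<^sub>R (\<phi> q - \<phi> p)"
    unfolding chart_segment_def by (auto intro: inv_into_into f_inv_into_f)
  with on_segment show "\<phi> (chart_segment U \<phi> p q \<alpha> t) \<in> closed_segment (\<phi> p) (\<phi> q)" by simp
qed

lemma chart_segment_endpoints:
  assumes "inj_on \<phi> U" "p \<in> U" "q \<in> U"
  shows "chart_segment U \<phi> p q \<alpha> \<alpha> = p" "chart_segment U \<phi> p q \<alpha> (\<alpha> + 1) = q"
  using assms by (simp_all add: chart_segment_def)

lemma chart_segment_has_vector_derivative:
  assumes "closed_segment (\<phi> p) (\<phi> q) \<subseteq> \<phi> ` U" "t \<in> {\<alpha>..\<alpha> + 1}"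
  shows "((\<phi> \<circ> chart_segment U \<phi> p q \<alpha>) has_vector_derivative \<phi> q - \<phi> p) (at t within {\<alpha>..\<alpha> + 1})"
proof (rule has_vector_derivative_transform[OF assms(2)])
  show "((\<lambda>t. \<phi> p + (t - \<alpha>) *\<^sub>R (\<phi> q - \<phi> p)) has_vector_derivative \<phi> q - \<phi> p)
    (at t within {\<alpha>..\<alpha> + 1})"
    by (auto intro!: derivative_eq_intros)
qed (simp add: chart_segment_in_chart[OF assms(1)])

definition piecewise_C1_joined ::
  "'a topology \<Rightarrow> ('a, 'e::euclidean_space) chart set \<Rightarrow> 'a \<Rightarrow> 'a \<Rightarrow> bool" where
  "piecewise_C1_joined X \<A> p q \<longleftrightarrow> (\<exists>c \<alpha> \<beta>. piecewise_C1_curve X \<A> c \<alpha> \<beta> \<and> c \<alpha> = p \<and> c \<beta> = q)"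

context smooth_manifold
begin

lemma chart_segment_C1_curve:
  assumes chart: "(U, \<phi>) \<in> \<A>" and segment: "closed_segment (\<phi> p) (\<phi> q) \<subseteq> \<phi> ` U"
  shows "C1_curve X \<A> (chart_segment U \<phi> p q \<alpha>) \<alpha> (\<alpha> + 1)"
proof (rule C1_curve_if_C1_in_chart[OF chart, where D = "\<lambda>_. \<phi> q - \<phi> p"])
  have "(\<lambda>t. \<phi> p + (t - \<alpha>) *\<^sub>R (\<phi> q - \<phi> p)) ` {\<alpha>..\<alpha> + 1} \<subseteq> \<phi> ` U"
    using chart_segment_in_chart(1)[OF segment]
    by (auto simp flip: chart_segment_in_chart(2)[OF segment])
  then have "continuous_map (top_of_set {\<alpha>..\<alpha> + 1}) (top_of_set (\<phi> ` U))
      (\<lambda>t. \<phi> p + (t - \<alpha>) *\<^sub>R (\<phi> q - \<phi> p))"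
    by (auto simp: continuous_map_in_subtopology intro!: continuous_intros)
  from continuous_map_compose[OF this chart_inverse_continuous[OF chart]]
  show "continuous_map (top_of_set {\<alpha>..\<alpha> + 1}) X (chart_segment U \<phi> p q \<alpha>)"
    by (simp add: chart_segment_def[abs_def] o_def)
qed (auto intro: chart_segment_in_chart(1)[OF segment]
      chart_segment_has_vector_derivative[OF segment])

lemma piecewise_C1_joined_refl:
  assumes "p \<in> topspace X"
  shows "piecewise_C1_joined X \<A> p p"
proof -
  obtain U \<phi> where chart: "(U, \<phi>) \<in> \<A>" "p \<in> U" using ex_chart[OF assms] .
  then have "C1_curve X \<A> (chart_segment U \<phi> p p 0) 0 (0 + 1)"
    by (intro chart_segment_C1_curve) auto
  then have "piecewise_C1_curve X \<A> (chart_segment U \<phi> p p 0) 0 (0 + 1)"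
    by (rule piecewise_C1_curve_if_C1_curve) simp
  then show ?thesis
    unfolding piecewise_C1_joined_def
    using chart_segment_endpoints[OF chart_inj[OF chart(1)] chart(2) chart(2)] by blast
qed

lemma piecewise_C1_joined_segment:
  assumes "piecewise_C1_joined X \<A> p x" and chart: "(U, \<phi>) \<in> \<A>" "x \<in> U" "y \<in> U"
    and segment: "closed_segment (\<phi> x) (\<phi> y) \<subseteq> \<phi> ` U"
  shows "piecewise_C1_joined X \<A> p y"
proof -
  obtain c \<alpha> \<beta> where curve: "piecewise_C1_curve X \<A> c \<alpha> \<beta>" "c \<alpha> = p" "c \<beta> = x"
    using assms(1) unfolding piecewise_C1_joined_def by blast
  let ?s = "chart_segment U \<phi> x y \<beta>"
  let ?c = "\<lambda>t. if t \<le> \<beta> then c t else ?s t"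
  have endpoints: "?s \<beta> = x" "?s (\<beta> + 1) = y"
    using chart_segment_endpoints[OF chart_inj[OF chart(1)] chart(2,3)] by auto
  have "piecewise_C1_curve X \<A> ?c \<alpha> (\<beta> + 1)"
    using curve endpoints
    by (intro piecewise_C1_curve_append chart_segment_C1_curve chart segment) auto
  moreover have "?c \<alpha> = p" "?c (\<beta> + 1) = y"
    using curve(2) endpoints piecewise_C1_curve_less[OF curve(1)] by auto
  ultimately show ?thesis unfolding piecewise_C1_joined_def by blast
qed

lemma connected_imp_piecewise_C1_joined:
  assumes "connected_space X" "p \<in> topspace X" "q \<in> topspace X"
  shows "piecewise_C1_joined X \<A> p q"
  using assms
proof (rule connected_space_induct)
  show "piecewise_C1_joined X \<A> p p" by (rule piecewise_C1_joined_refl) fact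
  fix x assume "x \<in> topspace X"
  then obtain U \<phi> where chart: "(U, \<phi>) \<in> \<A>" "x \<in> U" using ex_chart by blast
  then obtain r where ball: "r > 0" "ball (\<phi> x) r \<subseteq> \<phi> ` U"
    using chart_image[OF chart(1)] by (meson imageI openE)
  let ?W = "{y \<in> U. \<phi> y \<in> ball (\<phi> x) r}"
  have "piecewise_C1_joined X \<A> p z" if "y \<in> ?W" "z \<in> ?W" "piecewise_C1_joined X \<A> p y" for y z
  proof (rule piecewise_C1_joined_segment[OF that(3) chart(1)])
    show "closed_segment (\<phi> y) (\<phi> z) \<subseteq> \<phi> ` U"
      using closed_segment_subset[OF _ _ convex_ball, of "\<phi> y" "\<phi> x" r "\<phi> z"] that(1,2) ball(2)
      by blast
  qed (use that in auto)
  moreover have "openin X ?W" by (rule openin_chart_preimage[OF chart(1) open_ball])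
  moreover have "x \<in> ?W" using chart ball by simp
  ultimately show "\<exists>W. openin X W \<and> x \<in> W \<and>
      (\<forall>y\<in>W. \<forall>z\<in>W. piecewise_C1_joined X \<A> p y \<longrightarrow> piecewise_C1_joined X \<A> p z)"
    by blast
qed

end

section \<open>Local comparison of the Riemannian distance with a Euclidean one\<close>

context riemannian_manifold
begin

definition speed :: "(real \<Rightarrow> 'a) \<Rightarrow> real set \<Rightarrow> real \<Rightarrow> real" where
  "speed c S t = (let ch = chart_at \<A> (c t)
     in form_norm (g ch (c t)) (vector_derivative (snd ch \<circ> c) (at t within S)))"

lemma curve_length_eq_integral_speed:
  "curve_length \<A> g c \<alpha> \<beta> = integral {\<alpha>..\<beta>} (speed c {\<alpha>..\<beta>})"
  by (simp add: curve_length_def speed_def[abs_def] form_norm_def Let_def)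

lemma inner_form_metric:
  assumes "(U, \<phi>) \<in> \<A>" "p \<in> U"
  shows "inner_form (g (U, \<phi>) p)"
  using assms by unfold_locales (blast intro: metric_bilinear metric_sym metric_pos)+

lemma speed_nonneg:
  assumes "c t \<in> topspace X"
  shows "speed c S t \<ge> 0"
proof -
  obtain U \<phi> where chart_at: "chart_at \<A> (c t) = (U, \<phi>)" by (cases "chart_at \<A> (c t)")
  then have "(U, \<phi>) \<in> \<A>" "c t \<in> U" using chart_at_in_atlas[OF assms] by auto
  from inner_form.form_norm_nonneg[OF inner_form_metric[OF this]] show ?thesis
    by (simp add: speed_def chart_at Let_def)
qed

lemma speed_in_chart:
  assumes curve: "continuous_map (top_of_set S) X c" and t_mem: "t \<in> S" "at t within S \<noteq> bot"
    and chart: "(U, \<phi>) \<in> \<A>" "c t \<in> U"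
    and deriv: "((\<phi> \<circ> c) has_vector_derivative v) (at t within S)"
  shows "speed c S t = form_norm (g (U, \<phi>) (c t)) v"
proof -
  have "c t \<in> topspace X" using chart chart_domain_subset by blast
  obtain V \<psi> where chart_at: "chart_at \<A> (c t) = (V, \<psi>)" by (cases "chart_at \<A> (c t)")
  then have selected: "(V, \<psi>) \<in> \<A>" "c t \<in> V" using chart_at_in_atlas[OF \<open>c t \<in> topspace X\<close>] by auto
  have "vector_derivative (\<psi> \<circ> c) (at t within S) =
      frechet_derivative (transition (U, \<phi>) (V, \<psi>)) (at (\<phi> (c t))) v"
    using chart selected
      curve_derivative_change_chart[OF curve t_mem(1) _ chart(1) selected(1) deriv]
    by (intro vector_derivative_within t_mem(2)) simp
  then show ?thesis
    using metric_transform[OF chart(1) selected(1), of "c t" v v] chart selected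
    by (simp add: speed_def chart_at Let_def form_norm_def)
qed

lemma metric_continuous_on:
  assumes chart: "(U, \<phi>) \<in> \<A>" and base: "continuous_on S x" "x ` S \<subseteq> \<phi> ` U"
    and "continuous_on S v" "continuous_on S w"
  shows "continuous_on S (\<lambda>s. g (U, \<phi>) (inv_into U \<phi> (x s)) (v s) (w s))"
proof -
  have coeff: "continuous_on S (\<lambda>s. g (U, \<phi>) (inv_into U \<phi> (x s)) i j)" for i j
  proof (rule continuous_on_compose2[OF _ base])
    have "Ck_on 0 (\<phi> ` U) (\<lambda>x. g (U, \<phi>) (inv_into U \<phi> x) i j)"
      using metric_smooth[OF chart, of i j] unfolding smooth_on_def by blast
    then show "continuous_on (\<phi> ` U) (\<lambda>x. g (U, \<phi>) (inv_into U \<phi> x) i j)" by simp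
  qed
  have "continuous_on S (\<lambda>s. \<Sum>i\<in>Basis. \<Sum>j\<in>Basis. (v s \<bullet> i) * (w s \<bullet> j) *
      g (U, \<phi>) (inv_into U \<phi> (x s)) i j)"
    by (intro continuous_intros coeff assms)
  then show ?thesis
  proof (rule continuous_on_eq)
    fix s assume "s \<in> S"
    then have "inv_into U \<phi> (x s) \<in> U" using base(2) by (intro inv_into_into) blast
    then show "(\<Sum>i\<in>Basis. \<Sum>j\<in>Basis. (v s \<bullet> i) * (w s \<bullet> j) * g (U, \<phi>) (inv_into U \<phi> (x s)) i j)
        = g (U, \<phi>) (inv_into U \<phi> (x s)) (v s) (w s)"
      by (intro bilinear_Basis_expansion[symmetric] metric_bilinear[OF chart])
  qed
qed

lemma eventually_metric_Basis_close:
  assumes chart: "(U, \<phi>) \<in> \<A>" "p0 \<in> U" and "\<eta> > 0"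
  shows "\<forall>\<^sub>F x in nhds (\<phi> p0). \<forall>i\<in>Basis. \<forall>j\<in>Basis.
    \<bar>g (U, \<phi>) (inv_into U \<phi> x) i j - g (U, \<phi>) p0 i j\<bar> < \<eta>"
proof (intro eventually_ball_finite finite_Basis ballI)
  fix i j :: 'e
  let ?g = "\<lambda>x. g (U, \<phi>) (inv_into U \<phi> x) i j"
  have "continuous_on (\<phi> ` U) ?g"
    by (rule metric_continuous_on[OF chart(1)]) (auto intro: continuous_intros)
  then have "isCont ?g (\<phi> p0)"
    using chart_image[OF chart(1)] chart(2) by (simp add: continuous_on_eq_continuous_at)
  then have "(?g \<longlongrightarrow> g (U, \<phi>) p0 i j) (nhds (\<phi> p0))"
    using chart chart_inj[OF chart(1)] by (simp add: isCont_def tendsto_nhds_iff)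
  from tendstoD[OF this \<open>\<eta> > 0\<close>] show "\<forall>\<^sub>F x in nhds (\<phi> p0). \<bar>?g x - g (U, \<phi>) p0 i j\<bar> < \<eta>"
    by (simp add: dist_real_def)
qed

lemma speed_continuous_on:
  assumes curve: "C1_curve X \<A> c \<alpha> \<beta>" and "\<alpha> < \<beta>"
  shows "continuous_on {\<alpha>..\<beta>} (speed c {\<alpha>..\<beta>})"
  unfolding continuous_on_eq_continuous_within
proof
  fix t assume t_mem: "t \<in> {\<alpha>..\<beta>}"
  note cont = C1_curve_continuous_map[OF curve]
  have "c t \<in> topspace X" using cont t_mem by (auto simp: continuous_map_def)
  then obtain U \<phi> where chart: "(U, \<phi>) \<in> \<A>" "c t \<in> U" using ex_chart by blast
  let ?S = "{\<alpha>..\<beta>} \<inter> c -` U"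
  obtain D where deriv: "continuous_on ?S D"
    "\<And>t. t \<in> {\<alpha>..\<beta>} \<Longrightarrow> c t \<in> U \<Longrightarrow> ((\<phi> \<circ> c) has_vector_derivative D t) (at t within {\<alpha>..\<beta>})"
    using C1_curve_derivative[OF curve chart(1)] by blast
  have "continuous_map (top_of_set ?S) X c"
    using cont by (rule continuous_map_from_subtopology_mono) simp
  then have "continuous_on ?S (\<phi> \<circ> c)" by (rule chart_comp_continuous_on[OF chart(1)]) simp
  then have "continuous_on ?S (\<lambda>s. sqrt (g (U, \<phi>) (inv_into U \<phi> ((\<phi> \<circ> c) s)) (D s) (D s)))"
    by (intro continuous_on_real_sqrt metric_continuous_on[OF chart(1)] deriv(1)) auto
  then have "continuous_on ?S (speed c {\<alpha>..\<beta>})"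
  proof (rule continuous_on_eq)
    fix s assume s_mem: "s \<in> ?S"
    then have "at s within {\<alpha>..\<beta>} \<noteq> bot"
      using \<open>\<alpha> < \<beta>\<close> by (simp add: trivial_limit_within islimpt_Icc)
    then show "sqrt (g (U, \<phi>) (inv_into U \<phi> ((\<phi> \<circ> c) s)) (D s) (D s)) = speed c {\<alpha>..\<beta>} s"
      using speed_in_chart[OF cont _ _ chart(1) _ deriv(2), of s] s_mem chart_inj[OF chart(1)]
      by (simp add: form_norm_def)
  qed
  then have "continuous (at t within ?S) (speed c {\<alpha>..\<beta>})"
    using t_mem chart by (simp add: continuous_on_eq_continuous_within)
  moreover have "at t within ?S = at t within {\<alpha>..\<beta>}"
  proof -
    obtain \<delta> where stays_in_U: "\<delta> > 0" "\<And>s. s \<in> {\<alpha>..\<beta>} \<Longrightarrow> dist s t < \<delta> \<Longrightarrow> c s \<in> U"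
      using curve_preimage_ball[OF cont chart_domain[OF chart(1)] t_mem chart(2)] by blast
    show ?thesis
      by (rule at_within_nhd[of t "ball t \<delta>"]) (use stays_in_U in \<open>auto simp: dist_commute\<close>)
  qed
  ultimately show "continuous (at t within {\<alpha>..\<beta>}) (speed c {\<alpha>..\<beta>})" by simp
qed

lemma speed_interior:
  "t \<in> interior S \<Longrightarrow> speed c S t = speed c UNIV t"
  by (simp add: speed_def at_within_interior[of t S])

lemma speed_integrable_on_iff_UNIV:
  "speed c {\<alpha>..\<beta>} integrable_on {\<alpha>..\<beta>} \<longleftrightarrow> speed c UNIV integrable_on {\<alpha>..\<beta>}"
proof (rule integrable_spike_finite_eq)
  show "speed c {\<alpha>..\<beta>} t = speed c UNIV t" if "t \<in> {\<alpha>..\<beta>} - {\<alpha>, \<beta>}" for t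
    by (rule speed_interior) (use that in simp)
qed simp

lemma speed_integrable:
  assumes "piecewise_C1_curve X \<A> c \<alpha> \<beta>"
  shows "speed c {\<alpha>..\<beta>} integrable_on {\<alpha>..\<beta>}"
proof -
  have integrable_piece: "speed c UNIV integrable_on {u..v}" if "C1_curve X \<A> c u v" "u < v" for u v
    using integrable_continuous_real[OF speed_continuous_on[OF that]]
    by (simp add: speed_integrable_on_iff_UNIV)
  from assms have "speed c UNIV integrable_on {\<alpha>..\<beta>}"
  proof (induction rule: piecewise_C1_curve_induct)
    case (extend \<beta> \<beta>')
    show ?case
      by (rule Henstock_Kurzweil_Integration.integrable_combine[OF _ _ extend.IH
            integrable_piece[OF extend.hyps(3,2)]])
        (use extend.hyps piecewise_C1_curve_less[OF extend.hyps(1)] in auto)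
  qed (rule integrable_piece)
  then show ?thesis by (simp add: speed_integrable_on_iff_UNIV)
qed

lemma curve_length_nonneg:
  assumes "piecewise_C1_curve X \<A> c \<alpha> \<beta>"
  shows "curve_length \<A> g c \<alpha> \<beta> \<ge> 0"
  unfolding curve_length_eq_integral_speed
  by (intro integral_nonneg speed_integrable speed_nonneg
      piecewise_C1_curve_in_topspace[OF assms] assms)

lemma integral_speed_le_curve_length:
  assumes curve: "piecewise_C1_curve X \<A> c \<alpha> \<beta>" and T_mem: "T \<in> {\<alpha>..\<beta>}"
  shows "speed c {\<alpha>..\<beta>} integrable_on {T..\<beta>}"
    and "integral {T..\<beta>} (speed c {\<alpha>..\<beta>}) \<le> curve_length \<A> g c \<alpha> \<beta>"
proof -
  show integrable: "speed c {\<alpha>..\<beta>} integrable_on {T..\<beta>}"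
    using speed_integrable[OF curve] by (rule integrable_on_subinterval) (use T_mem in auto)
  show "integral {T..\<beta>} (speed c {\<alpha>..\<beta>}) \<le> curve_length \<A> g c \<alpha> \<beta>"
    unfolding curve_length_eq_integral_speed
    by (intro integral_subset_le integrable speed_integrable curve ballI speed_nonneg
        piecewise_C1_curve_in_topspace[OF curve]) (use T_mem in auto)
qed

lemma displacement_le_curve_length:
  assumes curve: "piecewise_C1_curve X \<A> c \<alpha> \<beta>" and T_mem: "T \<in> {\<alpha>..\<beta>}" and chart: "(U, \<phi>) \<in> \<A>"
    and in_U: "\<And>t. t \<in> {T..\<beta>} \<Longrightarrow> c t \<in> U"
    and form: "inner_form G" and "\<kappa> > 0"
    and bound: "\<And>t v. t \<in> {T..\<beta>} \<Longrightarrow> \<kappa> * form_norm G v \<le> form_norm (g (U, \<phi>) (c t)) v"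
  shows "\<kappa> * form_dist G (\<phi> (c \<beta>)) (\<phi> (c T)) \<le> curve_length \<A> g c \<alpha> \<beta>"
proof -
  let ?speed = "speed c {\<alpha>..\<beta>}"
  note cont = piecewise_C1_curve_continuous_map[OF curve]
  obtain F where exceptional: "finite F"
    "\<And>t U \<phi>. t \<in> {\<alpha>..\<beta>} - F \<Longrightarrow> (U, \<phi>) \<in> \<A> \<Longrightarrow> c t \<in> U \<Longrightarrow>
      \<exists>v. ((\<phi> \<circ> c) has_vector_derivative v) (at t)"
    using piecewise_C1_curve_differentiable[OF curve] by blast
  have "\<exists>v. ((\<phi> \<circ> c) has_vector_derivative v) (at t)" if "t \<in> {T<..<\<beta>} - F" for t
    using that T_mem by (intro exceptional(2)[OF _ chart] in_U) auto
  then obtain v where deriv: "\<And>t. t \<in> {T<..<\<beta>} - F \<Longrightarrow> ((\<phi> \<circ> c) has_vector_derivative v t) (at t)"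
    by metis
  have "form_dist G ((\<phi> \<circ> c) \<beta>) ((\<phi> \<circ> c) T) \<le> integral {T..\<beta>} (\<lambda>t. ?speed t / \<kappa>)"
  proof (rule inner_form.form_dist_le_integral[OF form _ _ exceptional(1) deriv])
    have "continuous_map (top_of_set {T..\<beta>}) X c"
      using cont by (rule continuous_map_from_subtopology_mono) (use T_mem in auto)
    then show "continuous_on {T..\<beta>} (\<phi> \<circ> c)" by (rule chart_comp_continuous_on[OF chart _ in_U])
    show "(\<lambda>t. ?speed t / \<kappa>) integrable_on {T..\<beta>}"
      using integral_speed_le_curve_length(1)[OF curve T_mem] by (rule integrable_on_divide)
    show "0 \<le> ?speed t / \<kappa>" if "t \<in> {T..\<beta>}" for t
      using in_U[OF that] chart_domain_subset[OF chart] \<open>\<kappa> > 0\<close>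
      by (intro divide_nonneg_pos speed_nonneg) auto
    fix t assume t_mem: "t \<in> {T<..<\<beta>} - F"
    have "?speed t = form_norm (g (U, \<phi>) (c t)) (v t)"
      by (rule speed_in_chart[OF cont _ _ chart _
            has_vector_derivative_at_within[OF deriv[OF t_mem]]])
        (use t_mem T_mem in_U in \<open>auto simp: trivial_limit_within islimpt_Icc\<close>)
    then show "form_norm G (v t) \<le> ?speed t / \<kappa>"
      using bound[of t "v t"] t_mem \<open>\<kappa> > 0\<close> by (simp add: pos_le_divide_eq mult.commute)
  qed (use T_mem in auto)
  also have "\<dots> = integral {T..\<beta>} ?speed / \<kappa>" by simp
  finally have "\<kappa> * form_dist G (\<phi> (c \<beta>)) (\<phi> (c T)) \<le> integral {T..\<beta>} ?speed"
    using \<open>\<kappa> > 0\<close> by (simp add: pos_le_divide_eq mult.commute)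
  also have "\<dots> \<le> curve_length \<A> g c \<alpha> \<beta>"
    by (rule integral_speed_le_curve_length(2)[OF curve T_mem])
  finally show ?thesis .
qed

lemma le_riemannian_dist:
  assumes "connected_space X" "p \<in> topspace X" "q \<in> topspace X"
    and "\<And>c \<alpha> \<beta>. piecewise_C1_curve X \<A> c \<alpha> \<beta> \<Longrightarrow> c \<alpha> = p \<Longrightarrow> c \<beta> = q \<Longrightarrow>
      l \<le> curve_length \<A> g c \<alpha> \<beta>"
  shows "l \<le> riemannian_dist X \<A> g p q"
proof -
  have "l \<le> Inf {curve_length \<A> g c \<alpha> \<beta> | c \<alpha> \<beta>.
      piecewise_C1_curve X \<A> c \<alpha> \<beta> \<and> c \<alpha> = p \<and> c \<beta> = q}"
    using connected_imp_piecewise_C1_joined[OF assms(1-3)] unfolding piecewise_C1_joined_def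
    by (intro cInf_greatest) (use assms(4) in blast)+
  then show ?thesis using assms(2,3) by (simp add: riemannian_dist_def)
qed

lemma riemannian_dist_le_curve_length:
  assumes curve: "piecewise_C1_curve X \<A> c \<alpha> \<beta>"
  shows "riemannian_dist X \<A> g (c \<alpha>) (c \<beta>) \<le> curve_length \<A> g c \<alpha> \<beta>"
proof -
  have "c \<alpha> \<in> topspace X" "c \<beta> \<in> topspace X"
    using piecewise_C1_curve_in_topspace[OF curve] piecewise_C1_curve_less[OF curve] by auto
  moreover have "Inf {curve_length \<A> g c' \<alpha>' \<beta>' | c' \<alpha>' \<beta>'.
      piecewise_C1_curve X \<A> c' \<alpha>' \<beta>' \<and> c' \<alpha>' = c \<alpha> \<and> c' \<beta>' = c \<beta>} \<le> curve_length \<A> g c \<alpha> \<beta>"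
    by (rule cInf_lower) (use curve curve_length_nonneg in \<open>auto intro!: bdd_belowI[of _ 0]\<close>)
  ultimately show ?thesis by (simp add: riemannian_dist_def)
qed

lemma in_topspace_if_riemannian_dist_pos:
  "0 < riemannian_dist X \<A> g p q \<Longrightarrow> p \<in> topspace X \<and> q \<in> topspace X"
  by (auto simp: riemannian_dist_def split: if_splits)

lemma riemannian_dist_nonneg:
  assumes "connected_space X"
  shows "riemannian_dist X \<A> g p q \<ge> 0"
proof (cases "p \<in> topspace X \<and> q \<in> topspace X")
  case True
  then show ?thesis using le_riemannian_dist[OF assms] curve_length_nonneg by blast
qed (auto simp: riemannian_dist_def)

lemma riemannian_dist_le_in_chart:
  assumes chart: "(U, \<phi>) \<in> \<A>" "p \<in> U" "q \<in> U" and segment: "closed_segment (\<phi> p) (\<phi> q) \<subseteq> \<phi> ` U"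
    and bound: "\<And>p'. p' \<in> U \<Longrightarrow> \<phi> p' \<in> closed_segment (\<phi> p) (\<phi> q) \<Longrightarrow>
      form_norm (g (U, \<phi>) p') (\<phi> q - \<phi> p) \<le> l"
  shows "riemannian_dist X \<A> g p q \<le> l"
proof -
  let ?c = "chart_segment U \<phi> p q 0"
  have C1: "C1_curve X \<A> ?c 0 1" using chart_segment_C1_curve[OF chart(1) segment, of 0] by simp
  have curve: "piecewise_C1_curve X \<A> ?c 0 1" by (intro piecewise_C1_curve_if_C1_curve C1) simp
  have "riemannian_dist X \<A> g p q \<le> curve_length \<A> g ?c 0 1"
    using riemannian_dist_le_curve_length[OF curve]
      chart_segment_endpoints[OF chart_inj[OF chart(1)] chart(2,3), of 0]
    by simp
  also have "\<dots> \<le> integral {0..1::real} (\<lambda>_. l)"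
    unfolding curve_length_eq_integral_speed
  proof (rule integral_le[OF speed_integrable[OF curve]])
    fix t :: real assume t_mem: "t \<in> {0..1}"
    then have t_mem': "t \<in> {0..0 + 1}" by simp
    have "speed ?c {0..1} t = form_norm (g (U, \<phi>) (?c t)) (\<phi> q - \<phi> p)"
      using chart_segment_in_chart(1)[OF segment t_mem'] t_mem
        chart_segment_has_vector_derivative[OF segment t_mem']
      by (intro speed_in_chart[OF C1_curve_continuous_map[OF C1] _ _ chart(1)])
        (auto simp: trivial_limit_within islimpt_Icc)
    also have "\<dots> \<le> l" using chart_segment_in_chart(1,3)[OF segment t_mem'] by (rule bound)
    finally show "speed ?c {0..1} t \<le> l" .
  qed auto
  finally show ?thesis by simp
qed

end

locale almost_flat_chart = riemannian_manifold X \<A> g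
  for X :: "'a topology" and \<A> :: "('a, 'e::euclidean_space) chart set"
    and g :: "('a, 'e) chart \<Rightarrow> 'a \<Rightarrow> 'e \<Rightarrow> 'e \<Rightarrow> real" +
  fixes U :: "'a set" and \<phi> :: "'a \<Rightarrow> 'e" and p0 :: 'a and R \<epsilon> :: real
  assumes chart: "(U, \<phi>) \<in> \<A>" and center: "p0 \<in> U" and radius_pos: "R > 0"
    and eps: "0 < \<epsilon>" "\<epsilon> < 1"
    and form_cball_subset: "{x. form_dist (g (U, \<phi>) p0) x (\<phi> p0) \<le> R} \<subseteq> \<phi> ` U"
    and metric_close: "\<And>p v. p \<in> U \<Longrightarrow> form_dist (g (U, \<phi>) p0) (\<phi> p) (\<phi> p0) \<le> R \<Longrightarrow>
      rel_close \<epsilon> (form_norm (g (U, \<phi>) p) v) (form_norm (g (U, \<phi>) p0) v)"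

lemma (in riemannian_manifold) ex_almost_flat_chart:
  assumes chart: "(U, \<phi>) \<in> \<A>" "p0 \<in> U" and eps: "0 < \<epsilon>" "\<epsilon> < 1"
  shows "\<exists>R. almost_flat_chart X \<A> g U \<phi> p0 R \<epsilon>"
proof -
  let ?G = "g (U, \<phi>) p0"
  interpret G: inner_form ?G by (rule inner_form_metric[OF chart])
  obtain m where m_bound: "m > 0" "\<And>v. m * norm v \<le> form_norm ?G v"
    using G.ex_norm_le_form_norm by blast
  obtain \<eta> where "\<eta> > 0" and Basis_close: "\<And>H v. inner_form H \<Longrightarrow>
      (\<And>i j. i \<in> Basis \<Longrightarrow> j \<in> Basis \<Longrightarrow> \<bar>H i j - ?G i j\<bar> \<le> \<eta>) \<Longrightarrow>
      rel_close \<epsilon> (form_norm H v) (form_norm ?G v)"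
    using G.form_norm_rel_close_if_Basis_close[OF eps(1)] by blast
  have "\<forall>\<^sub>F x in nhds (\<phi> p0). x \<in> \<phi> ` U"
    using chart_image[OF chart(1)] chart(2) by (intro eventually_nhds_in_open) auto
  from eventually_conj[OF this eventually_metric_Basis_close[OF chart \<open>\<eta> > 0\<close>]]
  obtain r where ball: "r > 0" "\<And>x. dist x (\<phi> p0) < r \<Longrightarrow> x \<in> \<phi> ` U \<and>
      (\<forall>i\<in>Basis. \<forall>j\<in>Basis. \<bar>g (U, \<phi>) (inv_into U \<phi> x) i j - ?G i j\<bar> < \<eta>)"
    unfolding eventually_nhds_metric by blast
  have near: "dist x (\<phi> p0) < r" if "form_dist ?G x (\<phi> p0) \<le> m * (r / 2)" for x
  proof -
    have "m * dist x (\<phi> p0) \<le> m * (r / 2)"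
      unfolding dist_norm by (rule order_trans[OF m_bound(2) that])
    then have "dist x (\<phi> p0) \<le> r / 2" using m_bound(1) by (rule mult_left_le_imp_le)
    then show ?thesis using ball(1) by simp
  qed
  have "almost_flat_chart X \<A> g U \<phi> p0 (m * (r / 2)) \<epsilon>"
  proof
    show "{x. form_dist ?G x (\<phi> p0) \<le> m * (r / 2)} \<subseteq> \<phi> ` U" using near ball(2) by blast
    fix p v assume p_mem: "p \<in> U" "form_dist ?G (\<phi> p) (\<phi> p0) \<le> m * (r / 2)"
    then have "\<bar>g (U, \<phi>) p i j - ?G i j\<bar> \<le> \<eta>" if "i \<in> Basis" "j \<in> Basis" for i j
      using ball(2)[OF near[OF p_mem(2)]] that chart_inj[OF chart(1)] by (simp add: less_imp_le)
    then show "rel_close \<epsilon> (form_norm (g (U, \<phi>) p) v) (form_norm ?G v)"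
      using inner_form_metric[OF chart(1) p_mem(1)] by (intro Basis_close)
  qed (use chart eps m_bound(1) ball(1) in auto)
  then show ?thesis ..
qed

context almost_flat_chart
begin

abbreviation G :: "'e \<Rightarrow> 'e \<Rightarrow> real" where "G \<equiv> g (U, \<phi>) p0"

sublocale G: inner_form G
  by (rule inner_form_metric[OF chart center])

abbreviation radius :: "'a \<Rightarrow> real" where "radius p \<equiv> form_dist G (\<phi> p) (\<phi> p0)"

lemma curve_length_ge:
  assumes curve: "piecewise_C1_curve X \<A> c \<alpha> \<beta>" and end_in: "c \<beta> \<in> U" "radius (c \<beta>) < R"
    and escape: "l \<le> R - radius (c \<beta>)"
    and stay: "c \<alpha> \<in> U \<Longrightarrow> l \<le> form_dist G (\<phi> (c \<beta>)) (\<phi> (c \<alpha>))"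
  shows "(1 - \<epsilon>) * l \<le> curve_length \<A> g c \<alpha> \<beta>"
proof -
  let ?V = "{p \<in> U. \<phi> p \<in> {x. form_dist G x (\<phi> p0) < R}}"
  let ?K = "{p \<in> U. \<phi> p \<in> {x. form_dist G x (\<phi> p0) \<le> R}}"
  have "openin X ?V" by (rule openin_chart_preimage[OF chart G.open_form_ball])
  moreover have "\<alpha> \<le> \<beta>" "c \<beta> \<in> ?V" using piecewise_C1_curve_less[OF curve] end_in by auto
  ultimately obtain T where exit_time: "T \<in> {\<alpha>..\<beta>}" "\<And>t. t \<in> {T..\<beta>} \<Longrightarrow> c t \<in> X closure_of ?V"
    "T = \<alpha> \<or> c T \<notin> ?V"
    using last_exit_time[OF piecewise_C1_curve_continuous_map[OF curve]] by blast
  have "X closure_of ?V \<subseteq> ?K"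
    by (intro closure_of_minimal closedin_chart_preimage_compact chart G.compact_form_cball
        form_cball_subset)
      auto
  with exit_time have after_T: "c t \<in> U" "radius (c t) \<le> R" if "t \<in> {T..\<beta>}" for t
    using that by blast+
  have "l \<le> form_dist G (\<phi> (c \<beta>)) (\<phi> (c T))"
  proof (cases "T = \<alpha>")
    case True
    then show ?thesis using stay after_T(1)[of T] exit_time(1) by simp
  next
    case False
    then have "radius (c T) = R" using exit_time(1,3) after_T[of T] by auto
    then show ?thesis
      using escape G.form_dist_triangle[of "\<phi> (c T)" "\<phi> p0" "\<phi> (c \<beta>)"]
        G.form_dist_commute[of "\<phi> (c T)" "\<phi> (c \<beta>)"] by linarith
  qed
  then have "(1 - \<epsilon>) * l \<le> (1 - \<epsilon>) * form_dist G (\<phi> (c \<beta>)) (\<phi> (c T))"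
    using eps by (intro mult_left_mono) auto
  also have "\<dots> \<le> curve_length \<A> g c \<alpha> \<beta>"
    using metric_close after_T eps unfolding rel_close_iff
    by (intro displacement_le_curve_length[OF curve exit_time(1) chart _ G.inner_form_axioms]) auto
  finally show ?thesis .
qed

lemma riemannian_dist_ge:
  assumes "connected_space X" "p \<in> topspace X" and q_mem: "q \<in> U" "radius q < R"
    and "l \<le> R - radius q" "p \<in> U \<Longrightarrow> l \<le> form_dist G (\<phi> q) (\<phi> p)"
  shows "(1 - \<epsilon>) * l \<le> riemannian_dist X \<A> g p q"
proof (rule le_riemannian_dist[OF assms(1,2)])
  show "q \<in> topspace X" using q_mem(1) chart_domain_subset[OF chart] by blast
  show "(1 - \<epsilon>) * l \<le> curve_length \<A> g c \<alpha> \<beta>"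
    if "piecewise_C1_curve X \<A> c \<alpha> \<beta>" "c \<alpha> = p" "c \<beta> = q" for c \<alpha> \<beta>
    using assms that by (intro curve_length_ge) auto
qed

lemma riemannian_dist_le:
  assumes "p \<in> U" "q \<in> U" "radius p \<le> R" "radius q \<le> R"
  shows "riemannian_dist X \<A> g p q \<le> (1 + \<epsilon>) * form_dist G (\<phi> q) (\<phi> p)"
proof (rule riemannian_dist_le_in_chart[OF chart assms(1,2)])
  have segment: "closed_segment (\<phi> p) (\<phi> q) \<subseteq> {x. form_dist G x (\<phi> p0) \<le> R}"
    by (intro closed_segment_subset G.convex_form_cball) (use assms in auto)
  then show "closed_segment (\<phi> p) (\<phi> q) \<subseteq> \<phi> ` U" using form_cball_subset by blast
  fix p' assume "p' \<in> U" "\<phi> p' \<in> closed_segment (\<phi> p) (\<phi> q)"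
  with segment have "rel_close \<epsilon> (form_norm (g (U, \<phi>) p') (\<phi> q - \<phi> p)) (form_dist G (\<phi> q) (\<phi> p))"
    by (intro metric_close) auto
  then show "form_norm (g (U, \<phi>) p') (\<phi> q - \<phi> p) \<le> (1 + \<epsilon>) * form_dist G (\<phi> q) (\<phi> p)"
    by (simp add: rel_close_iff)
qed

lemma radius_less_if_riemannian_dist_less:
  assumes "connected_space X" "q \<in> topspace X" "riemannian_dist X \<A> g q p0 < (1 - \<epsilon>) * (R / 3)"
  shows "q \<in> U \<and> radius q < R / 3"
proof (rule ccontr)
  assume "\<not> ?thesis"
  then have "(1 - \<epsilon>) * (R / 3) \<le> riemannian_dist X \<A> g q p0"
    using radius_pos G.form_dist_commute[of "\<phi> p0" "\<phi> q"]
    by (intro riemannian_dist_ge assms center) (auto simp: G.form_norm_zero)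
  with assms(3) show False by simp
qed

text \<open>The factor 3: two points of radius below \<open>R / 3\<close> are at most \<open>2 * R / 3\<close> apart, which is also
  the least that a curve from one of them has to travel to leave the ball of radius \<open>R\<close>.\<close>

lemma riemannian_dist_rel_close:
  assumes "connected_space X" "p \<in> U" "q \<in> U" "radius p < R / 3" "radius q < R / 3"
  shows "rel_close \<epsilon> (riemannian_dist X \<A> g p q) (form_dist G (\<phi> p) (\<phi> q))"
proof -
  have "form_dist G (\<phi> q) (\<phi> p) \<le> R - radius q"
    using assms(4,5) G.form_dist_triangle[of "\<phi> q" "\<phi> p" "\<phi> p0"]
      G.form_dist_commute[of "\<phi> p" "\<phi> p0"]
    by linarith
  then have "(1 - \<epsilon>) * form_dist G (\<phi> q) (\<phi> p) \<le> riemannian_dist X \<A> g p q"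
    using assms radius_pos chart_domain_subset[OF chart] by (intro riemannian_dist_ge) auto
  moreover have "riemannian_dist X \<A> g p q \<le> (1 + \<epsilon>) * form_dist G (\<phi> q) (\<phi> p)"
    using assms radius_pos by (intro riemannian_dist_le) auto
  ultimately show ?thesis
    by (simp add: rel_close_iff G.form_dist_commute[of "\<phi> p" "\<phi> q"])
qed

end

context riemannian_manifold
begin

lemma chart_almost_isometric_on_metric_ball:
  assumes "connected_space X" and chart_p0: "(U, \<phi>) \<in> \<A>" "p0 \<in> U" and eps_bounds: "0 < \<epsilon>" "\<epsilon> < 1"
  obtains \<rho> where "\<rho> > 0"
    "\<And>p q. \<lbrakk>p \<in> topspace X; q \<in> topspace X;
      riemannian_dist X \<A> g p p0 < \<rho>; riemannian_dist X \<A> g q p0 < \<rho>\<rbrakk> \<Longrightarrow>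
      rel_close \<epsilon> (riemannian_dist X \<A> g p q) (form_dist (g (U, \<phi>) p0) (\<phi> p) (\<phi> q))"
proof -
  obtain R where "almost_flat_chart X \<A> g U \<phi> p0 R \<epsilon>"
    using ex_almost_flat_chart[OF chart_p0 eps_bounds] ..
  then interpret almost_flat_chart X \<A> g U \<phi> p0 R \<epsilon> .
  show thesis
  proof
    show "(1 - \<epsilon>) * (R / 3) > 0" using eps radius_pos by simp
    show "rel_close \<epsilon> (riemannian_dist X \<A> g p q) (form_dist G (\<phi> p) (\<phi> q))"
      if "p \<in> topspace X" "q \<in> topspace X"
        "riemannian_dist X \<A> g p p0 < (1 - \<epsilon>) * (R / 3)"
        "riemannian_dist X \<A> g q p0 < (1 - \<epsilon>) * (R / 3)" for p q
      using radius_less_if_riemannian_dist_less[OF assms(1)] that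
      by (intro riemannian_dist_rel_close assms(1)) auto
  qed
qed

lemma near_snowflake_in_chart:
  assumes connected: "connected_space X" and chart: "(U, \<phi>) \<in> \<A>" "p0 \<in> U" and "\<delta> > 0"
  obtains \<epsilon> \<rho> where "\<epsilon> > 0" "\<rho> > 0"
    "\<And>\<alpha> L \<gamma> S. \<lbrakk>near_snowflake (riemannian_dist X \<A> g) \<alpha> L \<epsilon> \<gamma> S; 0 \<le> L;
      \<And>t. t \<in> S \<Longrightarrow> \<gamma> t \<in> topspace X \<and> riemannian_dist X \<A> g (\<gamma> t) p0 < \<rho>\<rbrakk> \<Longrightarrow>
      near_snowflake (form_dist (g (U, \<phi>) p0)) \<alpha> L \<delta> (\<phi> \<circ> \<gamma>) S"
proof -
  define \<epsilon> where "\<epsilon> = min (1 / 2) (\<delta> / 4)"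
  have eps: "0 < \<epsilon>" "\<epsilon> < 1" "\<epsilon> \<le> 1 / 2" "4 * \<epsilon> \<le> \<delta>" using \<open>\<delta> > 0\<close> by (auto simp: \<epsilon>_def)
  obtain \<rho> where "\<rho> > 0" and almost_isometric: "\<And>p q. \<lbrakk>p \<in> topspace X; q \<in> topspace X;
      riemannian_dist X \<A> g p p0 < \<rho>; riemannian_dist X \<A> g q p0 < \<rho>\<rbrakk> \<Longrightarrow>
      rel_close \<epsilon> (riemannian_dist X \<A> g p q) (form_dist (g (U, \<phi>) p0) (\<phi> p) (\<phi> q))"
    using chart_almost_isometric_on_metric_ball[OF connected chart eps(1,2)] by blast
  show thesis
  proof
    fix \<alpha> L \<gamma> S
    assume "near_snowflake (riemannian_dist X \<A> g) \<alpha> L \<epsilon> \<gamma> S" "0 \<le> L"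
      and "\<And>t. t \<in> S \<Longrightarrow> \<gamma> t \<in> topspace X \<and> riemannian_dist X \<A> g (\<gamma> t) p0 < \<rho>"
    then show "near_snowflake (form_dist (g (U, \<phi>) p0)) \<alpha> L \<delta> (\<phi> \<circ> \<gamma>) S"
      using eps by (elim near_snowflake_transfer) (auto intro: almost_isometric)
  qed fact+
qed

lemma no_near_snowflake_curve_near_point:
  assumes connected: "connected_space X" and "p0 \<in> topspace X" and exponent: "0 < \<alpha>" "\<alpha> < 1"
  obtains \<epsilon> \<rho> where "\<epsilon> > 0" "\<rho> > 0"
    "\<And>L u v \<gamma>. \<lbrakk>L > 0; u < v;
      \<And>t. t \<in> {u..v} \<Longrightarrow> \<gamma> t \<in> topspace X \<and> riemannian_dist X \<A> g (\<gamma> t) p0 < \<rho>\<rbrakk> \<Longrightarrow>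
      \<not> near_snowflake (riemannian_dist X \<A> g) \<alpha> L \<epsilon> \<gamma> {u..v}"
proof -
  obtain U \<phi> where chart: "(U, \<phi>) \<in> \<A>" "p0 \<in> U" using ex_chart[OF \<open>p0 \<in> topspace X\<close>] .
  interpret G: inner_form "g (U, \<phi>) p0" by (rule inner_form_metric[OF chart])
  obtain \<delta> where "\<delta> > 0" and no_snowflake: "\<And>L u v x. L > 0 \<Longrightarrow> u < v \<Longrightarrow>
      \<not> near_snowflake (form_dist (g (U, \<phi>) p0)) \<alpha> L \<delta> x {u..v}"
    using G.no_near_snowflake_curve[OF exponent] by blast
  from near_snowflake_in_chart[OF connected chart \<open>\<delta> > 0\<close>] obtain \<epsilon> \<rho> where "\<epsilon> > 0" "\<rho> > 0"
    and in_chart: "\<And>L \<gamma> S. \<lbrakk>near_snowflake (riemannian_dist X \<A> g) \<alpha> L \<epsilon> \<gamma> S; 0 \<le> L;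
      \<And>t. t \<in> S \<Longrightarrow> \<gamma> t \<in> topspace X \<and> riemannian_dist X \<A> g (\<gamma> t) p0 < \<rho>\<rbrakk> \<Longrightarrow>
      near_snowflake (form_dist (g (U, \<phi>) p0)) \<alpha> L \<delta> (\<phi> \<circ> \<gamma>) S"
    by metis
  show thesis
  proof
    show "\<not> near_snowflake (riemannian_dist X \<A> g) \<alpha> L \<epsilon> \<gamma> {u..v}"
      if "L > 0" "u < v" "\<And>t. t \<in> {u..v} \<Longrightarrow> \<gamma> t \<in> topspace X \<and> riemannian_dist X \<A> g (\<gamma> t) p0 < \<rho>"
      for L u v \<gamma>
    proof
      assume "near_snowflake (riemannian_dist X \<A> g) \<alpha> L \<epsilon> \<gamma> {u..v}"
      from in_chart[OF this less_imp_le[OF that(1)] that(3)] no_snowflake[OF that(1,2)]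
      show False by blast
    qed
  qed fact+
qed

end

section \<open>m-differentiable curves\<close>

definition m_speed :: "('a \<Rightarrow> 'a \<Rightarrow> real) \<Rightarrow> real \<Rightarrow> real \<Rightarrow> real \<Rightarrow> (real \<Rightarrow> 'a) \<Rightarrow> real \<Rightarrow> real" where
  "m_speed d k a b \<gamma> t = Lim (at 0 within {s. t + s \<in> {a..b}}) (m_quotient d k \<gamma> t)"

lemma meas_eq_m_speed_powr: "meas d k a b \<gamma> t = m_speed d k a b \<gamma> t powr k"
  by (simp add: meas_def m_speed_def)

lemma m_speed_tendsto:
  assumes "a < b" "t \<in> {a..b}" "m_differentiable d k a b \<gamma> t"
  shows "((\<lambda>t'. d (\<gamma> t') (\<gamma> t) / \<bar>t' - t\<bar> powr (1 / k)) \<longlongrightarrow> m_speed d k a b \<gamma> t) (at t within {a..b})"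
proof -
  let ?S = "{s. t + s \<in> {a..b}}"
  obtain l where limit: "(m_quotient d k \<gamma> t \<longlongrightarrow> l) (at 0 within ?S)"
    using assms(3) unfolding m_differentiable_def by blast
  have "?S = {a - t..b - t}" by auto
  then have "at 0 within ?S \<noteq> bot"
    using assms(1,2) by (simp add: trivial_limit_within islimpt_Icc)
  then have "m_speed d k a b \<gamma> t = l" unfolding m_speed_def using limit by (rule tendsto_Lim)
  moreover have "filterlim (\<lambda>t'. t' - t) (at 0 within ?S) (at t within {a..b})"
    unfolding filterlim_at by (auto simp: eventually_at_filter intro!: tendsto_eq_intros)
  from filterlim_compose[OF limit this]
  have "((\<lambda>t'. d (\<gamma> t') (\<gamma> t) / \<bar>t' - t\<bar> powr (1 / k)) \<longlongrightarrow> l) (at t within {a..b})"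
    by (simp add: m_quotient_def)
  ultimately show ?thesis by simp
qed

lemma m_speed_nonneg:
  assumes "\<And>p q. 0 \<le> d p q" "a < b" "t \<in> {a..b}" "m_differentiable d k a b \<gamma> t"
  shows "0 \<le> m_speed d k a b \<gamma> t"
proof (rule tendsto_lowerbound[OF m_speed_tendsto[OF assms(2-4)]])
  show "at t within {a..b} \<noteq> bot"
    using assms(2,3) by (simp add: trivial_limit_within islimpt_Icc)
qed (simp add: assms(1))

lemma m_speed_continuous_on:
  assumes "\<And>p q. 0 \<le> d p q" "a < b" "0 < k" and curve: "m_C1 M d k a b \<gamma>"
  shows "continuous_on {a..b} (m_speed d k a b \<gamma>)"
proof -
  have "continuous_on {a..b} (\<lambda>t. meas d k a b \<gamma> t powr (1 / k))"
    using curve \<open>0 < k\<close>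
    by (intro continuous_on_powr' continuous_intros) (auto simp: m_C1_def meas_eq_m_speed_powr)
  then show ?thesis
  proof (rule continuous_on_eq)
    fix t assume "t \<in> {a..b}"
    then have "0 \<le> m_speed d k a b \<gamma> t"
      using curve by (intro m_speed_nonneg assms) (auto simp: m_C1_def)
    then show "meas d k a b \<gamma> t powr (1 / k) = m_speed d k a b \<gamma> t"
      using \<open>0 < k\<close> by (simp add: meas_eq_m_speed_powr powr_powr)
  qed
qed

lemma eventually_at_within_Icc_subinterval:
  fixes a b t0 :: real
  assumes "\<forall>\<^sub>F t in at t0 within {a..b}. P t" "a < b" "t0 \<in> {a..b}"
  obtains u v where "u < v" "{u..v} \<subseteq> {a..b}" "\<And>t. t \<in> {u..v} \<Longrightarrow> P t"
proof -
  obtain S where nbhd: "open S" "t0 \<in> S" "\<And>t. t \<in> S \<Longrightarrow> t \<noteq> t0 \<Longrightarrow> t \<in> {a..b} \<Longrightarrow> P t"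
    using assms(1) unfolding eventually_at_topological by blast
  have "t0 islimpt {a<..<b}"
    using assms(2,3) by (metis closure_greaterThanLessThan islimpt_Icc limpt_of_closure)
  then obtain y where "y \<in> S \<inter> {a<..<b} - {t0}" using nbhd(1,2) unfolding islimpt_def by blast
  moreover have "open (S \<inter> {a<..<b} - {t0})" using nbhd(1) by (intro open_delete open_Int) auto
  ultimately obtain e where ball: "e > 0" "cball y e \<subseteq> S \<inter> {a<..<b} - {t0}"
    unfolding open_contains_cball by blast
  show thesis
  proof
    show "y - e < y + e" using ball(1) by simp
    show "{y - e..y + e} \<subseteq> {a..b}" "\<And>t. t \<in> {y - e..y + e} \<Longrightarrow> P t"
      using ball(2) nbhd(3) by (auto simp: cball_eq_atLeastAtMost subset_iff)
  qed
qed

lemma near_snowflake_if_m_speed_close: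
  assumes "a < b" and subset: "{u..v} \<subseteq> {a..b}" and "0 < \<epsilon> * L"
    and diff: "\<And>t. t \<in> {u..v} \<Longrightarrow> m_differentiable d k a b \<gamma> t"
    and close: "\<And>t. t \<in> {u..v} \<Longrightarrow> \<bar>m_speed d k a b \<gamma> t - L\<bar> < \<epsilon> * L / 2"
  shows "near_snowflake d (1 / k) L \<epsilon> \<gamma> {u..v}"
  unfolding near_snowflake_def
proof
  fix t assume t_mem: "t \<in> {u..v}"
  let ?Q = "\<lambda>t'. d (\<gamma> t') (\<gamma> t) / \<bar>t' - t\<bar> powr (1 / k)"
  have "(?Q \<longlongrightarrow> m_speed d k a b \<gamma> t) (at t within {a..b})"
    using t_mem subset by (intro m_speed_tendsto diff \<open>a < b\<close>) auto
  then have "(?Q \<longlongrightarrow> m_speed d k a b \<gamma> t) (at t within {u..v})"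
    using subset by (rule tendsto_within_subset)
  then have "\<forall>\<^sub>F t' in at t within {u..v}. dist (?Q t') (m_speed d k a b \<gamma> t) < \<epsilon> * L / 2"
    by (rule tendstoD) (use \<open>0 < \<epsilon> * L\<close> in simp)
  moreover have "\<forall>\<^sub>F t' in at t within {u..v}. t' \<noteq> t" by (simp add: eventually_at_filter)
  ultimately show "\<forall>\<^sub>F t' in at t within {u..v}.
      rel_close \<epsilon> (d (\<gamma> t') (\<gamma> t)) (L * \<bar>t' - t\<bar> powr (1 / k))"
  proof eventually_elim
    case (elim t')
    have "rel_close \<epsilon> (?Q t') L"
      using elim(1) close[OF t_mem] unfolding rel_close_def dist_real_def by linarith
    then show ?case
      using rel_close_mult_right[of \<epsilon> "?Q t'" L "\<bar>t' - t\<bar> powr (1 / k)"] elim(2) by simp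
  qed
qed

lemma m_C1_ex_near_snowflake:
  fixes d :: "'a \<Rightarrow> 'a \<Rightarrow> real"
  assumes d_nonneg: "\<And>p q. 0 \<le> d p q" and "a < b" "0 < k" and curve: "m_C1 M d k a b \<gamma>"
    and nonzero_meas: "t0 \<in> {a..b}" "meas d k a b \<gamma> t0 \<noteq> 0" and "0 < \<epsilon>" "0 < \<rho>"
  obtains L u v where "L > 0" "u < v" "near_snowflake d (1 / k) L \<epsilon> \<gamma> {u..v}"
    "\<And>t. t \<in> {u..v} \<Longrightarrow> 0 < d (\<gamma> t) (\<gamma> t0) \<and> d (\<gamma> t) (\<gamma> t0) < \<rho>"
proof -
  have diff: "m_differentiable d k a b \<gamma> t" if "t \<in> {a..b}" for t
    using curve that by (simp add: m_C1_def)
  define L where "L = m_speed d k a b \<gamma> t0"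
  have "0 \<le> L" unfolding L_def by (intro m_speed_nonneg d_nonneg \<open>a < b\<close> nonzero_meas diff)
  with nonzero_meas(2) have "L > 0" by (auto simp: meas_eq_m_speed_powr L_def less_le)
  let ?Q = "\<lambda>t. d (\<gamma> t) (\<gamma> t0) / \<bar>t - t0\<bar> powr (1 / k)"
  have quotient: "(?Q \<longlongrightarrow> L) (at t0 within {a..b})"
    unfolding L_def by (intro m_speed_tendsto \<open>a < b\<close> nonzero_meas diff)
  have "(m_speed d k a b \<gamma> \<longlongrightarrow> L) (at t0 within {a..b})"
    using m_speed_continuous_on[OF d_nonneg \<open>a < b\<close> \<open>0 < k\<close> curve] nonzero_meas(1)
    by (auto simp: continuous_on_def L_def)
  then have "\<forall>\<^sub>F t in at t0 within {a..b}. dist (m_speed d k a b \<gamma> t) L < \<epsilon> * L / 2"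
    by (rule tendstoD) (simp add: \<open>0 < \<epsilon>\<close> \<open>L > 0\<close>)
  moreover have "\<forall>\<^sub>F t in at t0 within {a..b}. 0 < ?Q t"
    using quotient \<open>L > 0\<close> by (rule order_tendstoD(1))
  moreover have "\<forall>\<^sub>F t in at t0 within {a..b}. ?Q t * \<bar>t - t0\<bar> powr (1 / k) < \<rho>"
  proof (rule order_tendstoD(2))
    show "((\<lambda>t. ?Q t * \<bar>t - t0\<bar> powr (1 / k)) \<longlongrightarrow> L * 0) (at t0 within {a..b})"
      using \<open>0 < k\<close> by (intro tendsto_mult quotient tendsto_abs_diff_powr_0) simp
  qed (simp add: \<open>0 < \<rho>\<close>)
  ultimately have "\<forall>\<^sub>F t in at t0 within {a..b}. \<bar>m_speed d k a b \<gamma> t - L\<bar> < \<epsilon> * L / 2 \<and>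
      0 < d (\<gamma> t) (\<gamma> t0) \<and> d (\<gamma> t) (\<gamma> t0) < \<rho>"
    by eventually_elim (auto simp: zero_less_divide_iff dist_real_def)
  from eventually_at_within_Icc_subinterval[OF this \<open>a < b\<close> nonzero_meas(1)]
  obtain u v where "u < v" "{u..v} \<subseteq> {a..b}" "\<And>t. t \<in> {u..v} \<Longrightarrow>
      \<bar>m_speed d k a b \<gamma> t - L\<bar> < \<epsilon> * L / 2 \<and> 0 < d (\<gamma> t) (\<gamma> t0) \<and> d (\<gamma> t) (\<gamma> t0) < \<rho>"
    by blast
  with \<open>0 < \<epsilon>\<close> \<open>L > 0\<close> show thesis
    by (intro that[of L u v] near_snowflake_if_m_speed_close[OF \<open>a < b\<close>] diff) auto
qed

theorem proposition2:
  fixes X :: "'a topology"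
    and \<A> :: "('a, 'e::euclidean_space) chart set"
    and g :: "('a, 'e) chart \<Rightarrow> 'a \<Rightarrow> 'e \<Rightarrow> 'e \<Rightarrow> real"
    and k a b :: real
    and \<gamma> :: "real \<Rightarrow> 'a"
  assumes "riemannian_manifold X \<A> g"
    and "connected_space X"
    and "k \<ge> 1"
    and "a < b"
    and "m_C1 (topspace X) (riemannian_dist X \<A> g) k a b \<gamma>"
    and "\<exists>t\<in>{a..b}. meas (riemannian_dist X \<A> g) k a b \<gamma> t \<noteq> 0"
  shows "k = 1"
proof (rule ccontr)
  assume "k \<noteq> 1"
  with \<open>k \<ge> 1\<close> have exponent: "0 < k" "0 < 1 / k" "1 / k < 1" by auto
  interpret riemannian_manifold X \<A> g by fact
  let ?d = "riemannian_dist X \<A> g"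
  obtain t0 where nonzero_meas: "t0 \<in> {a..b}" "meas ?d k a b \<gamma> t0 \<noteq> 0" using assms(6) by blast
  note near_snowflake_nearby = m_C1_ex_near_snowflake[OF
      riemannian_dist_nonneg[OF \<open>connected_space X\<close>] \<open>a < b\<close> exponent(1) assms(5) nonzero_meas]
  obtain t where "0 < ?d (\<gamma> t) (\<gamma> t0)"
    using near_snowflake_nearby[of 1 1]
    by (metis atLeastAtMost_iff less_imp_le order_refl zero_less_one)
  then have "\<gamma> t0 \<in> topspace X" using in_topspace_if_riemannian_dist_pos by blast
  then obtain \<epsilon> \<rho> where "\<epsilon> > 0" "\<rho> > 0" and no_snowflake: "\<And>L u v. \<lbrakk>L > 0; u < v;
      \<And>t. t \<in> {u..v} \<Longrightarrow> \<gamma> t \<in> topspace X \<and> ?d (\<gamma> t) (\<gamma> t0) < \<rho>\<rbrakk> \<Longrightarrow>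
      \<not> near_snowflake ?d (1 / k) L \<epsilon> \<gamma> {u..v}"
    using no_near_snowflake_curve_near_point[OF \<open>connected_space X\<close> _ exponent(2,3)] by metis
  obtain L u v where "L > 0" "u < v" "near_snowflake ?d (1 / k) L \<epsilon> \<gamma> {u..v}"
    and "\<And>t. t \<in> {u..v} \<Longrightarrow> 0 < ?d (\<gamma> t) (\<gamma> t0) \<and> ?d (\<gamma> t) (\<gamma> t0) < \<rho>"
    using near_snowflake_nearby[OF \<open>\<epsilon> > 0\<close> \<open>\<rho> > 0\<close>] by blast
  with no_snowflake[of L u v] show False using in_topspace_if_riemannian_dist_pos by blast
qed

end
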